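(* Let $C$ be a polytopal complex in $\mathbb{R}^d$ with $d\ge 3$, or a simplicial complex in $\mathbb{R}^2$ (in which case $d=2$). If $C$ is star-shaped in $\mathbb{R}^d$, then $\mathrm{sd}^{d-2}(C)$ is non-evasive, and in particular collapsible.
   Context: A polytopal complex in $\mathbb{R}^d$ is a finite collection of convex polytopes in $\mathbb{R}^d$, closed under taking faces, such that the intersection of any two polytopes is a face of both; it is simplicial if all its faces are simplices. Its underlying space $|C|$ is the union of its faces. A subset $X\subset\mathbb{R}^d$ is star-shaped if there is a point $x\in X$ such that for each $y\in X$ the segment $[x,y]$ lies in $X$; a complex is star-shaped if its underlying space is. A derived subdivision $\mathrm{sd}\, C$ is any subdivision obtained by stellarly subdividing all faces of $C$ in order of decreasing dimension. Equivalently, one chooses a point in the relative interior of each nonempty face, and the simplices are the convex hulls of the points corresponding to chains of nonempty faces; its face poset is that of the order complex of the poset of nonempty faces of $C$. The iterates are $\mathrm{sd}^0 C=C$, $\mathrm{sd}^{m}C=\mathrm{sd}(\mathrm{sd}^{m-1}C)$. For a vertex $v$ of a simplicial complex $K$, the deletion $K-v$ is the subcomplex of all faces not containing $v$, and the link $\mathrm{Lk}(v,K)$ is (combinatorially) the complex of all faces $\tau$ with $v\notin\tau$ such that $\tau$ and $v$ together span a face of $K$. Non-evasiveness: a $0$-dimensional complex is non-evasive if and only if it is a single point; recursively, a simplicial complex of dimension $>0$ is non-evasive if and only if it has some vertex whose link and deletion are both non-evasive. A free face $\sigma$ of a complex is a nonempty face strictly contained in exactly one other face. An elementary collapse deletes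 a free face $\sigma$ (together with the unique face strictly containing it). A complex is collapsible if it can be reduced to a single vertex by a sequence of elementary collapses. *)

theory Defs
  imports "HOL-Analysis.Analysis"
begin

text \<open>
  Complexes are geometric: families of convex subsets of a Euclidean space. As the library counts
  the empty set among the faces of every convex set, every nonempty complex contains it; this is
  also the convention of the library's \<^const>\<open>simplicial_complex\<close>.
\<close>

definition polytopal_complex :: "'a::euclidean_space set set \<Rightarrow> bool" where
  "polytopal_complex C \<longleftrightarrow>
     finite C \<and>
     (\<forall>P\<in>C. polytope P) \<and>
     (\<forall>F P. P \<in> C \<and> F face_of P \<longrightarrow> F \<in> C) \<and>
     (\<forall>P\<in>C. \<forall>Q\<in>C. P \<inter> Q face_of P \<and> P \<inter> Q face_of Q)"

text \<open>
  The points \<open>p F\<close> are arbitrary, so this is a relation: \<open>D\<close> is some derived subdivision of \<open>C\<close>.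
  The empty chain contributes the empty face of \<open>D\<close>.
\<close>

definition derived_subdivision :: "'a::euclidean_space set set \<Rightarrow> 'a set set \<Rightarrow> bool" where
  "derived_subdivision C D \<longleftrightarrow>
     (\<exists>p. (\<forall>F\<in>C - {{}}. p F \<in> rel_interior F) \<and>
          D = {convex hull (p ` c) | c. subset.chain (C - {{}}) c})"

definition complex_dim :: "'a::euclidean_space set set \<Rightarrow> int" where
  "complex_dim K = Max (aff_dim ` K)"

text \<open>
  In a simplicial complex \<open>K\<close> with \<open>{v} \<in> K\<close>, the point \<open>v\<close> lies in a face \<open>F\<close> exactly if it is
  a vertex of \<open>F\<close>. The link is the combinatorial one.
\<close>

definition deletion :: "'a \<Rightarrow> 'a set set \<Rightarrow> 'a set set" where
  "deletion v K = {F \<in> K. v \<notin> F}"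

definition link :: "'a::real_vector \<Rightarrow> 'a set set \<Rightarrow> 'a set set" where
  "link v K = {F \<in> K. v \<notin> F \<and> convex hull (insert v F) \<in> K}"

text \<open>
  Meant for simplicial complexes. A complex consisting of a single point \<open>v\<close> is \<open>{{}, {v}}\<close>.
\<close>

inductive non_evasive :: "'a::euclidean_space set set \<Rightarrow> bool" where
  point: "non_evasive {{}, {v}}"
| step: "\<lbrakk>complex_dim K > 0; {v} \<in> K; non_evasive (link v K); non_evasive (deletion v K)\<rbrakk>
           \<Longrightarrow> non_evasive K"

definition elementary_collapse :: "'a set set \<Rightarrow> 'a set set \<Rightarrow> bool" where
  "elementary_collapse K L \<longleftrightarrow>
     (\<exists>\<sigma> \<tau>. \<sigma> \<in> K \<and> \<sigma> \<noteq> {} \<and> {\<rho> \<in> K. \<sigma> \<subset> \<rho>} = {\<tau>} \<and> L = K - {\<sigma>, \<tau>})"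

definition collapsible :: "'a set set \<Rightarrow> bool" where
  "collapsible K \<longleftrightarrow> (\<exists>v. elementary_collapse\<^sup>*\<^sup>* K {{}, {v}})"

end

theory Submission
  imports Defs
begin

text \<open>
  The heart of the proof is a statement about one derived subdivision: the order complex of the
  nonempty faces of a star-shaped polyhedral complex, with unbounded polyhedra allowed, is
  non-evasive (\<open>star_shaped_order_complex_non_evasive\<close>). Let \<open>x\<close> be a star center, and let \<open>m P\<close> be
  the point of the face \<open>P\<close> that is closest to \<open>x\<close>. The faces are deleted in the order of decreasing
  distance of \<open>m P\<close> from \<open>x\<close>, and of decreasing dimension among faces of equal distance. Consider the
  moment when \<open>P\<close> is deleted, and put \<open>y = m P\<close>. If \<open>y\<close> lies in the relative boundary of \<open>P\<close>, then
  the smallest face that contains \<open>y\<close> is comparable to all faces in the link of \<open>P\<close>, and the link is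
  a cone. If \<open>y\<close> lies in the relative interior of \<open>P\<close>, then the link is spanned by those faces above
  \<open>P\<close> that come closer to \<open>x\<close> than \<open>y\<close>. By convexity these are the faces whose tangent cone at \<open>y\<close>
  meets the open half-space towards \<open>x\<close>. Cutting the tangent cones with the hyperplane through \<open>x\<close>
  orthogonal to \<open>x - y\<close> turns them into a polyhedral complex of smaller dimension with the same face
  poset. It is again star-shaped about \<open>x\<close>, because moving towards \<open>x\<close> is possible everywhere in
  the union of the tangent cones, and induction on the dimension applies. The slices are usually
  unbounded, which is why polytopes alone do not form a class that is closed under the induction.
  The faces that remain in the end are those containing \<open>x\<close>, and they form a cone.

  A derived subdivision realises the order complex geometrically and has the same underlying space
  (\<open>geometric_scheme_chains\<close>, \<open>Union_hull_chains\<close>). So for \<open>d \<ge> 3\<close> the complex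
  \<open>sd\<^sup>d\<^sup>-\<^sup>2 C\<close> is the derived subdivision of the star-shaped complex \<open>sd\<^sup>d\<^sup>-\<^sup>3 C\<close>.

  For \<open>d = 2\<close> the complex itself, rather than a subdivision, has to be dismantled. Since its
  barycentric subdivision is non-evasive, it is connected and has Euler characteristic 1. In the
  plane, the link of a vertex that is extreme in a generic direction is a forest
  (\<open>forest_like_link_of_extreme_vertex\<close>), and from this it follows that a connected planar complex
  has Euler characteristic at most 1. Now delete an extreme vertex which is not a cut vertex: the
  remaining complex has characteristic at most 1, so the forest cannot have two components, and the
  link is a tree. Cut vertices split the complex into two smaller ones with the same properties. So
  there is always a vertex with non-evasive link whose deletion is connected of characteristic 1.

  Collapsibility follows from non-evasiveness by lifting collapses of links to cones
  (\<open>abstract_non_evasive_imp_collapsible\<close>).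
\<close>

section \<open>Non-evasive abstract complexes\<close>

definition abstract_complex :: "'v set set \<Rightarrow> bool" where
  "abstract_complex X \<longleftrightarrow> finite X \<and> (\<forall>s\<in>X. finite s \<and> Pow s \<subseteq> X)"

definition vertex_deletion :: "'v \<Rightarrow> 'v set set \<Rightarrow> 'v set set" where
  "vertex_deletion v X = {s \<in> X. v \<notin> s}"

definition vertex_link :: "'v \<Rightarrow> 'v set set \<Rightarrow> 'v set set" where
  "vertex_link v X = {s \<in> X. v \<notin> s \<and> insert v s \<in> X}"

text \<open>
  The condition of positive dimension in the second rule is implied: a non-evasive link has a
  vertex, and this vertex spans an edge with \<open>v\<close>.
\<close>

inductive abstract_non_evasive :: "'v set set \<Rightarrow> bool" where
  point: "abstract_non_evasive {{}, {v}}"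
| step: "\<lbrakk>{v} \<in> X; abstract_non_evasive (vertex_link v X);
           abstract_non_evasive (vertex_deletion v X)\<rbrakk> \<Longrightarrow> abstract_non_evasive X"

lemma abstract_complex_vertex_deletion:
  "abstract_complex X \<Longrightarrow> abstract_complex (vertex_deletion v X)"
  unfolding abstract_complex_def vertex_deletion_def by (auto simp: subset_iff)

lemma abstract_complex_image:
  assumes "abstract_complex X"
  shows "abstract_complex ((`) f ` X)"
proof -
  have "Pow (f ` s) \<subseteq> (`) f ` X" if "s \<in> X" for s
  proof -
    have "(`) f ` Pow s \<subseteq> (`) f ` X"
      using assms that unfolding abstract_complex_def by (intro image_mono) simp
    then show ?thesis by (simp add: image_Pow_surj)
  qed
  then show ?thesis using assms unfolding abstract_complex_def by simp
qed

lemma abstract_complex_vertex_link: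
  assumes "abstract_complex X"
  shows "abstract_complex (vertex_link v X)"
proof -
  have "Pow s \<subseteq> vertex_link v X" if s: "s \<in> vertex_link v X" for s
  proof
    fix t assume "t \<in> Pow s"
    then have t: "t \<subseteq> s" by simp
    have "t \<in> Pow s" "insert v t \<in> Pow (insert v s)" using t by auto
    then have "t \<in> X" "insert v t \<in> X"
      using s assms unfolding abstract_complex_def vertex_link_def by (blast dest: subsetD)+
    then show "t \<in> vertex_link v X" using s t by (auto simp: vertex_link_def)
  qed
  moreover have "finite (vertex_link v X)" "\<forall>s\<in>vertex_link v X. finite s"
    using assms by (simp_all add: abstract_complex_def vertex_link_def)
  ultimately show ?thesis unfolding abstract_complex_def by simp
qed

lemma abstract_complex_star_decomposition:
  assumes "abstract_complex X"
  shows "X = vertex_deletion v X \<union> insert v ` vertex_link v X"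
proof (intro equalityI subsetI)
  fix s assume s: "s \<in> X"
  show "s \<in> vertex_deletion v X \<union> insert v ` vertex_link v X"
  proof (cases "v \<in> s")
    case True
    then have "s - {v} \<in> vertex_link v X" "s = insert v (s - {v})"
      using s assms by (auto simp: vertex_link_def abstract_complex_def insert_absorb)
    then show ?thesis by blast
  qed (use s in \<open>auto simp: vertex_deletion_def\<close>)
qed (auto simp: vertex_link_def vertex_deletion_def)

lemma abstract_non_evasive_has_vertex: "abstract_non_evasive X \<Longrightarrow> \<exists>v. {v} \<in> X"
  by (induction rule: abstract_non_evasive.induct) auto

lemma abstract_non_evasive_image:
  assumes "abstract_non_evasive X" "inj_on f (\<Union>X)"
  shows "abstract_non_evasive ((`) f ` X)"
  using assms
proof (induction rule: abstract_non_evasive.induct)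
  case (point v)
  have "(`) f ` {{}, {v}} = {{}, {f v}}" by auto
  then show ?case by (simp add: abstract_non_evasive.point)
next
  case (step v X)
  have inj: "f w \<in> f ` s \<longleftrightarrow> w \<in> s" if "s \<in> X" "w \<in> \<Union>X" for s w
    using step.prems that by (auto simp: inj_on_def)
  have v: "v \<in> \<Union>X" using step.hyps(1) by auto
  have "vertex_link (f v) ((`) f ` X) = (`) f ` vertex_link v X"
  proof (intro equalityI subsetI)
    fix t assume "t \<in> vertex_link (f v) ((`) f ` X)"
    then obtain s s' where s: "s \<in> X" "t = f ` s" "f v \<notin> t" "s' \<in> X" "insert (f v) t = f ` s'"
      by (auto simp: vertex_link_def)
    have "f ` insert v s = f ` s'" using s by simp
    moreover have "insert v s \<subseteq> \<Union>X" "s' \<subseteq> \<Union>X" using s v by auto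
    ultimately have "insert v s = s'" using inj_on_image_eq_iff[OF step.prems] by blast
    moreover have "v \<notin> s" using s by auto
    ultimately show "t \<in> (`) f ` vertex_link v X"
      using s by (simp add: vertex_link_def)
  next
    fix t assume "t \<in> (`) f ` vertex_link v X"
    then obtain s where "s \<in> X" "v \<notin> s" "insert v s \<in> X" "t = f ` s"
      by (auto simp: vertex_link_def)
    then show "t \<in> vertex_link (f v) ((`) f ` X)"
      using inj[OF _ v, of s] by (simp add: vertex_link_def image_insert[symmetric] del: image_insert)
  qed
  moreover have "vertex_deletion (f v) ((`) f ` X) = (`) f ` vertex_deletion v X"
    unfolding vertex_deletion_def using inj[OF _ v] by blast
  moreover have "abstract_non_evasive ((`) f ` vertex_link v X)"
    by (rule step.IH(1)) (rule inj_on_subset[OF step.prems], auto simp: vertex_link_def)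
  moreover have "abstract_non_evasive ((`) f ` vertex_deletion v X)"
    by (rule step.IH(2)) (rule inj_on_subset[OF step.prems], auto simp: vertex_deletion_def)
  moreover have "{f v} \<in> (`) f ` X"
    using step.hyps(1) by (force intro: image_eqI[of _ _ "{v}"])
  ultimately show ?case
    by (metis abstract_non_evasive.step)
qed

lemma elementary_collapse_insert_vertex:
  assumes "elementary_collapse Y Z" and v: "\<forall>s\<in>Y. v \<notin> s" "\<forall>s\<in>K. v \<notin> s"
  shows "elementary_collapse (K \<union> insert v ` Y) (K \<union> insert v ` Z)"
proof -
  obtain \<sigma> \<tau> where st: "\<sigma> \<in> Y" "\<sigma> \<noteq> {}" "{\<rho> \<in> Y. \<sigma> \<subset> \<rho>} = {\<tau>}" "Z = Y - {\<sigma>, \<tau>}"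
    using assms(1) unfolding elementary_collapse_def by blast
  then have \<tau>: "\<tau> \<in> Y" "\<sigma> \<subset> \<tau>" by auto
  have psub: "insert v \<sigma> \<subset> insert v \<rho> \<longleftrightarrow> \<sigma> \<subset> \<rho>" if "\<rho> \<in> Y" for \<rho>
    using st(1) that v(1) unfolding psubset_eq
    by (metis insert_ident insert_mono subset_insert subset_insertI2 insert_subset)
  have up: "{\<rho> \<in> K \<union> insert v ` Y. insert v \<sigma> \<subset> \<rho>} = {insert v \<tau>}"
  proof (intro equalityI subsetI)
    fix \<rho> assume \<rho>: "\<rho> \<in> {\<rho> \<in> K \<union> insert v ` Y. insert v \<sigma> \<subset> \<rho>}"
    then have "\<rho> \<notin> K" using v(2) by auto
    then obtain \<rho>' where r: "\<rho>' \<in> Y" "\<rho> = insert v \<rho>'" using \<rho> by auto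
    then have "\<sigma> \<subset> \<rho>'" using \<rho> psub by auto
    then show "\<rho> \<in> {insert v \<tau>}" using st r by auto
  qed (use \<tau> psub in auto)
  have diff: "K \<union> insert v ` Z = K \<union> insert v ` Y - {insert v \<sigma>, insert v \<tau>}"
  proof -
    have "insert v ` Z = insert v ` Y - {insert v \<sigma>, insert v \<tau>}"
    proof -
      have "inj_on (insert v) Y" using v(1) by (meson inj_onI insert_ident)
      then show ?thesis
        unfolding st(4) using inj_on_image_set_diff[of "insert v" Y Y "{\<sigma>, \<tau>}"] st(1) \<tau>(1) by simp
    qed
    moreover have "insert v \<sigma> \<notin> K" "insert v \<tau> \<notin> K" using v(2) by blast+
    then have "K - {insert v \<sigma>, insert v \<tau>} = K" by simp
    ultimately show ?thesis by (simp add: Un_Diff)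
  qed
  show ?thesis
    unfolding elementary_collapse_def
  proof (intro exI conjI)
    show "insert v \<sigma> \<in> K \<union> insert v ` Y" using st(1) by blast
  qed (rule insert_not_empty up diff)+
qed

lemma elementary_collapse_subset: "elementary_collapse K L \<Longrightarrow> L \<subseteq> K"
  unfolding elementary_collapse_def by auto

lemma elementary_collapses_insert_vertex:
  assumes "elementary_collapse\<^sup>*\<^sup>* Y Z" and "\<forall>s\<in>Y. v \<notin> s" "\<forall>s\<in>K. v \<notin> s"
  shows "elementary_collapse\<^sup>*\<^sup>* (K \<union> insert v ` Y) (K \<union> insert v ` Z)"
  using assms
proof (induction rule: converse_rtranclp_induct)
  case (step Y Y')
  have "elementary_collapse (K \<union> insert v ` Y) (K \<union> insert v ` Y')"
    by (rule elementary_collapse_insert_vertex[OF step.hyps(1) step.prems])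
  moreover have "\<forall>s\<in>Y'. v \<notin> s"
    using step.prems(1) elementary_collapse_subset[OF step.hyps(1)] by auto
  ultimately show ?case
    using step.IH step.prems(2) by (meson converse_rtranclp_into_rtranclp)
qed simp

text \<open>
  A collapse of the link of \<open>v\<close> onto a point \<open>w\<close> lifts to the cone over the link: every face is
  joined with \<open>v\<close>. What is left of the star of \<open>v\<close> is then \<open>v\<close> itself and the edge \<open>vw\<close>, and
  \<open>v\<close> is free in it; so the complex collapses onto the deletion.
\<close>

lemma abstract_non_evasive_imp_collapsible:
  assumes "abstract_non_evasive X" "abstract_complex X"
  shows "collapsible X"
  using assms
proof (induction rule: abstract_non_evasive.induct)
  case (point v)
  then show ?case unfolding collapsible_def by blast
next
  case (step v X)
  let ?K = "vertex_deletion v X" and ?Y = "vertex_link v X"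
  obtain w where w: "elementary_collapse\<^sup>*\<^sup>* ?Y {{}, {w}}"
    using step.IH(1) abstract_complex_vertex_link[OF step.prems] unfolding collapsible_def by blast
  obtain u where u: "elementary_collapse\<^sup>*\<^sup>* ?K {{}, {u}}"
    using step.IH(2) abstract_complex_vertex_deletion[OF step.prems] unfolding collapsible_def by blast
  have sub: "{{}, {w}} \<subseteq> ?Y"
    using w by (induction rule: rtranclp_induct) (auto dest: elementary_collapse_subset)
  have vY: "\<forall>s\<in>?Y. v \<notin> s" and vK: "\<forall>s\<in>?K. v \<notin> s"
    by (auto simp: vertex_link_def vertex_deletion_def)
  have "elementary_collapse\<^sup>*\<^sup>* X (?K \<union> insert v ` {{}, {w}})"
    by (subst abstract_complex_star_decomposition[OF step.prems, of v])
      (rule elementary_collapses_insert_vertex[OF w vY vK])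
  also have "elementary_collapse (?K \<union> insert v ` {{}, {w}}) ?K"
  proof -
    have "v \<noteq> w" using sub vY by auto
    then have "{\<rho> \<in> ?K \<union> insert v ` {{}, {w}}. {v} \<subset> \<rho>} = {{v, w}}" using vK by auto
    moreover have "?K = ?K \<union> insert v ` {{}, {w}} - {{v}, {v, w}}" using vK by auto
    ultimately show ?thesis unfolding elementary_collapse_def by blast
  qed
  also note u
  finally show ?case unfolding collapsible_def by blast
qed

section \<open>Order complexes\<close>

definition order_complex :: "'b set set \<Rightarrow> 'b set set set" where
  "order_complex S = {c. subset.chain S c}"

definition comparable_elements :: "'b set \<Rightarrow> 'b set set \<Rightarrow> 'b set set" where
  "comparable_elements a S = {b \<in> S. b \<subset> a \<or> a \<subset> b}"

lemma order_complex_subset: "c \<in> order_complex S \<Longrightarrow> d \<subseteq> c \<Longrightarrow> d \<in> order_complex S"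
  by (simp add: order_complex_def subset_chain_def) (meson subset_trans subsetD)

lemma abstract_complex_order_complex: "finite S \<Longrightarrow> abstract_complex (order_complex S)"
proof -
  assume S: "finite S"
  have sub: "order_complex S \<subseteq> Pow S" by (auto simp: order_complex_def subset_chain_def)
  then show ?thesis
    using S sub order_complex_subset unfolding abstract_complex_def
    by (auto intro: finite_subset[of "order_complex S" "Pow S"] finite_subset[of _ S])
qed

lemma singleton_in_order_complex: "a \<in> S \<Longrightarrow> {a} \<in> order_complex S"
  by (auto simp: order_complex_def subset_chain_def)

lemma Union_order_complex: "\<Union>(order_complex S) = S"
proof
  show "\<Union>(order_complex S) \<subseteq> S" by (auto simp: order_complex_def subset_chain_def)
  show "S \<subseteq> \<Union>(order_complex S)" using singleton_in_order_complex by fast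
qed

lemma vertex_deletion_order_complex: "vertex_deletion a (order_complex S) = order_complex (S - {a})"
  by (auto simp: vertex_deletion_def order_complex_def subset_chain_def)

lemma vertex_link_order_complex:
  "a \<in> S \<Longrightarrow> vertex_link a (order_complex S) = order_complex (comparable_elements a S)"
  unfolding vertex_link_def order_complex_def comparable_elements_def subset_chain_insert
  unfolding subset_chain_def by blast

lemma order_complex_singleton: "order_complex {a} = {{}, {a}}"
  by (auto simp: order_complex_def subset_chain_def)

lemma abstract_non_evasive_order_complex_step:
  assumes "a \<in> S" "abstract_non_evasive (order_complex (comparable_elements a S))"
    "abstract_non_evasive (order_complex (S - {a}))"
  shows "abstract_non_evasive (order_complex S)"
  using abstract_non_evasive.step[of a "order_complex S"] assms
  by (simp add: singleton_in_order_complex vertex_deletion_order_complex vertex_link_order_complex)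

text \<open>
  If an element other than the apex is deleted, then both its link and what remains are again cones
  with this apex.
\<close>

lemma abstract_non_evasive_order_complex_cone:
  assumes "finite S" "a \<in> S" "\<forall>b\<in>S. b \<subseteq> a \<or> a \<subseteq> b"
  shows "abstract_non_evasive (order_complex S)"
  using assms
proof (induction "card S" arbitrary: S rule: less_induct)
  case less
  show ?case
  proof (cases "S = {a}")
    case True
    then show ?thesis by (simp add: order_complex_singleton abstract_non_evasive.point)
  next
    case False
    then obtain b where b: "b \<in> S" "b \<noteq> a" using less.prems by auto
    have "abstract_non_evasive (order_complex (comparable_elements b S))"
    proof (rule less.hyps)
      have "comparable_elements b S \<subset> S" using b by (auto simp: comparable_elements_def)
      then show "card (comparable_elements b S) < card S"
        using less.prems by (simp add: psubset_card_mono)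
    qed (use less.prems b in \<open>auto simp: comparable_elements_def\<close>)
    moreover have "abstract_non_evasive (order_complex (S - {b}))"
    proof (rule less.hyps)
      show "card (S - {b}) < card S" using b less.prems(1) by (meson card_Diff1_less)
    qed (use less.prems b in auto)
    ultimately show ?thesis
      using b abstract_non_evasive_order_complex_step by metis
  qed
qed

text \<open>
  The sweep: elements are deleted one by one, an \<open>R\<close>-largest one of those outside \<open>T\<close> first. At
  the moment when \<open>a\<close> is deleted, its link is spanned by the comparable elements below it in \<open>R\<close>.
\<close>

lemma abstract_non_evasive_order_complex_sweep:
  assumes "finite S" "T \<subseteq> S" "abstract_non_evasive (order_complex T)"
    and R: "\<And>a. \<not> R a a" "\<And>a b c. R a b \<Longrightarrow> R b c \<Longrightarrow> R a c"
      "\<And>a b. a \<in> S \<Longrightarrow> b \<in> S \<Longrightarrow> a \<subset> b \<Longrightarrow> R a b \<or> R b a"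
    and T: "\<And>a b. a \<in> T \<Longrightarrow> b \<in> S - T \<Longrightarrow> R a b"
    and link: "\<And>a. a \<in> S - T \<Longrightarrow>
      abstract_non_evasive (order_complex {b \<in> comparable_elements a S. R b a})"
  shows "abstract_non_evasive (order_complex S)"
  using assms(1,2,6-8)
proof (induction "card S" arbitrary: S rule: less_induct)
  case less
  show ?case
  proof (cases "S = T")
    case False
    have "finite (S - T)" "S - T \<noteq> {}" using less.prems(1,2) False by auto
    moreover have "asymp_on (S - T) R" "transp_on (S - T) R"
      using R(1,2) by (blast intro: asymp_onI transp_onI)+
    ultimately obtain a where a: "a \<in> S - T" "\<forall>b\<in>S - T. \<not> R a b"
      using Finite_Set.bex_max_element[of "S - T" R] R(1) by metis
    have eq: "{b \<in> comparable_elements a' (S - {a}). R b a'} = {b \<in> comparable_elements a' S. R b a'}"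
      if "a' \<in> S - {a} - T" for a'
      using a that by (auto simp: comparable_elements_def)
    have "abstract_non_evasive (order_complex (S - {a}))"
    proof (rule less.hyps)
      show "card (S - {a}) < card S" using a less.prems(1) by (meson DiffD1 card_Diff1_less)
    qed (use a less.prems eq in auto)
    moreover have "comparable_elements a S = {b \<in> comparable_elements a S. R b a}"
      using a less.prems(2,3,4) by (auto simp: comparable_elements_def) blast+
    then have "abstract_non_evasive (order_complex (comparable_elements a S))"
      using less.prems(5)[OF a(1)] by simp
    ultimately show ?thesis
      using a abstract_non_evasive_order_complex_step by (metis DiffD1)
  qed (use assms(3) in simp)
qed

lemma abstract_non_evasive_order_complex_iso:
  assumes "abstract_non_evasive (order_complex (f ` S))"
    and f: "\<And>a b. a \<in> S \<Longrightarrow> b \<in> S \<Longrightarrow> f a \<subseteq> f b \<Longrightarrow> a \<subseteq> b"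
      "\<And>a b. a \<in> S \<Longrightarrow> b \<in> S \<Longrightarrow> a \<subseteq> b \<Longrightarrow> f a \<subseteq> f b"
  shows "abstract_non_evasive (order_complex S)"
proof -
  have inj: "inj_on f S" using f by (metis inj_onI order_refl subset_antisym)
  let ?g = "inv_into S f"
  have "order_complex S = (`) ?g ` order_complex (f ` S)"
  proof (intro equalityI subsetI)
    fix c assume c: "c \<in> order_complex S"
    then have "c \<subseteq> S" "f ` c \<in> order_complex (f ` S)"
      using f(2) by (auto simp: order_complex_def subset_chain_def) (meson subsetD)+
    moreover from this have "c = ?g ` f ` c" by (simp add: inj)
    ultimately show "c \<in> (`) ?g ` order_complex (f ` S)" by blast
  next
    fix c assume "c \<in> (`) ?g ` order_complex (f ` S)"
    then obtain d where d: "d \<in> order_complex (f ` S)" "c = ?g ` d" by blast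
    then obtain e where e: "e \<subseteq> S" "d = f ` e"
      by (auto simp: order_complex_def subset_chain_def subset_image_iff)
    then have "c = e" using d inj by simp
    moreover have "e \<in> order_complex S"
      using d(1) e f(1) by (simp add: order_complex_def subset_chain_def) (meson subsetD)
    ultimately show "c \<in> order_complex S" by simp
  qed
  moreover have "inj_on ?g (\<Union>(order_complex (f ` S)))"
    by (rule inj_on_inv_into) (auto simp: order_complex_def subset_chain_def)
  ultimately show ?thesis
    using abstract_non_evasive_image[OF assms(1)] by metis
qed

section \<open>Polyhedral complexes and tangent cones\<close>

definition polyhedral_complex :: "'a::euclidean_space set set \<Rightarrow> bool" where
  "polyhedral_complex C \<longleftrightarrow>
     finite C \<and> (\<forall>P\<in>C. polyhedron P) \<and> (\<forall>F P. P \<in> C \<and> F face_of P \<longrightarrow> F \<in> C) \<and>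
     (\<forall>P\<in>C. \<forall>Q\<in>C. P \<inter> Q face_of P)"

lemma polyhedral_complexD:
  assumes "polyhedral_complex C"
  shows "finite C" "P \<in> C \<Longrightarrow> polyhedron P" "P \<in> C \<Longrightarrow> convex P" "P \<in> C \<Longrightarrow> closed P"
    "P \<in> C \<Longrightarrow> F face_of P \<Longrightarrow> F \<in> C" "P \<in> C \<Longrightarrow> Q \<in> C \<Longrightarrow> P \<inter> Q face_of P"
  using assms unfolding polyhedral_complex_def
  by (simp_all add: polyhedron_imp_convex polyhedron_imp_closed) blast

lemma polyhedral_complex_minimal_face:
  assumes C: "polyhedral_complex C" and P: "P \<in> C" "y \<in> P"
  obtains F where "F \<in> C" "F face_of P" "y \<in> rel_interior F"
proof -
  let ?M = "{Q \<in> C. Q face_of P \<and> y \<in> Q}"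
  have "finite ?M" "P \<in> ?M"
    using P polyhedral_complexD[OF C] by (auto simp: face_of_refl)
  then obtain F where F: "F \<in> ?M" "\<forall>Q\<in>?M. \<not> Q \<subset> F"
    using finite_has_minimal[of ?M] by (metis (lifting) empty_iff psubset_eq)
  have "y \<in> rel_interior F"
  proof (rule ccontr)
    assume "y \<notin> rel_interior F"
    then have "y \<in> rel_frontier F"
      using F polyhedral_complexD(4)[OF C] by (simp add: rel_frontier_def)
    then obtain G where "G face_of F" "G \<noteq> F" "y \<in> G"
      using F polyhedral_complexD(2)[OF C] rel_frontier_of_polyhedron_alt by blast
    moreover have "G \<in> C" "G face_of P"
      using F polyhedral_complexD(5)[OF C, of F G] \<open>G face_of F\<close> face_of_trans[of G F P] by simp_all
    moreover have "G \<subseteq> F" by (rule face_of_imp_subset[OF \<open>G face_of F\<close>])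
    ultimately show False using F(2) by auto
  qed
  then show thesis using that F by blast
qed

text \<open>
  In particular the face with \<open>y\<close> in its relative interior is the smallest face containing \<open>y\<close>.
\<close>

lemma polyhedral_complex_face_subset:
  assumes C: "polyhedral_complex C" and "F \<in> C" "P \<in> C" "y \<in> rel_interior F" "y \<in> P"
  shows "F \<subseteq> P"
proof -
  have "F \<inter> P face_of F" by (rule polyhedral_complexD(6)[OF C assms(2,3)])
  moreover have "F \<inter> P \<inter> rel_interior F \<noteq> {}" using assms rel_interior_subset by blast
  ultimately show ?thesis using subset_of_face_of by blast
qed

text \<open>
  The cone has its apex at \<open>y\<close> rather than at the origin, so it contains \<open>P\<close>; its point \<open>z\<close> stands
  for the direction \<open>z - y\<close>.
\<close>

definition tangent_cone :: "'a::euclidean_space \<Rightarrow> 'a set \<Rightarrow> 'a set" where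
  "tangent_cone y P = {z. \<exists>e>0. y + e *\<^sub>R (z - y) \<in> P}"

lemma convex_shrink_towards:
  fixes y z :: "'a::real_vector"
  assumes "convex P" "y \<in> P" "y + e *\<^sub>R (z - y) \<in> P" "0 \<le> d" "d \<le> e"
  shows "y + d *\<^sub>R (z - y) \<in> P"
proof (cases "e = 0")
  case False
  then have e: "e > 0" using assms by simp
  have "(1 - d / e) *\<^sub>R y + (d / e) *\<^sub>R (y + e *\<^sub>R (z - y)) \<in> P"
    using assms e by (intro convexD) auto
  also have "(1 - d / e) *\<^sub>R y + (d / e) *\<^sub>R (y + e *\<^sub>R (z - y)) = y + d *\<^sub>R (z - y)"
    using e by (simp add: algebra_simps)
  finally show ?thesis .
qed (use assms in simp)

lemma tangent_cone_common_scale: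
  assumes "convex P" "y \<in> P" "convex Q" "y \<in> Q" "z \<in> tangent_cone y P" "z' \<in> tangent_cone y Q"
  obtains e where "e > 0" "y + e *\<^sub>R (z - y) \<in> P" "y + e *\<^sub>R (z' - y) \<in> Q"
proof -
  obtain a b where "a > 0" "b > 0" "y + a *\<^sub>R (z - y) \<in> P" "y + b *\<^sub>R (z' - y) \<in> Q"
    using assms unfolding tangent_cone_def by blast
  then show thesis
    using convex_shrink_towards[OF assms(1,2), of a z "min a b"]
      convex_shrink_towards[OF assms(3,4), of b z' "min a b"] that[of "min a b"] by simp
qed

lemma tangent_cone_mono: "P \<subseteq> Q \<Longrightarrow> tangent_cone y P \<subseteq> tangent_cone y Q"
  unfolding tangent_cone_def by blast

lemma tangent_cone_Int:
  assumes "convex P" "convex Q" "y \<in> P" "y \<in> Q"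
  shows "tangent_cone y (P \<inter> Q) = tangent_cone y P \<inter> tangent_cone y Q"
proof
  show "tangent_cone y P \<inter> tangent_cone y Q \<subseteq> tangent_cone y (P \<inter> Q)"
  proof
    fix z assume "z \<in> tangent_cone y P \<inter> tangent_cone y Q"
    then obtain e where "e > 0" "y + e *\<^sub>R (z - y) \<in> P" "y + e *\<^sub>R (z - y) \<in> Q"
      using tangent_cone_common_scale[of P y Q z z] assms by blast
    then show "z \<in> tangent_cone y (P \<inter> Q)" unfolding tangent_cone_def by blast
  qed
qed (simp add: tangent_cone_mono)

lemma convex_tangent_cone:
  assumes "convex P" "y \<in> P"
  shows "convex (tangent_cone y P)"
proof (rule convexI)
  fix a b u v :: real and p q
  assume pq: "p \<in> tangent_cone y P" "q \<in> tangent_cone y P" and uv: "0 \<le> u" "0 \<le> v" "u + v = 1"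
  obtain e where e: "e > 0" "y + e *\<^sub>R (p - y) \<in> P" "y + e *\<^sub>R (q - y) \<in> P"
    using tangent_cone_common_scale[OF assms assms pq] .
  have "u *\<^sub>R (y + e *\<^sub>R (p - y)) + v *\<^sub>R (y + e *\<^sub>R (q - y)) \<in> P"
    using assms(1) e uv by (simp add: convexD)
  also have "u *\<^sub>R (y + e *\<^sub>R (p - y)) + v *\<^sub>R (y + e *\<^sub>R (q - y))
      = (u + v) *\<^sub>R y + e *\<^sub>R ((u *\<^sub>R p + v *\<^sub>R q) - (u + v) *\<^sub>R y)"
    by (simp add: algebra_simps)
  finally show "u *\<^sub>R p + v *\<^sub>R q \<in> tangent_cone y P"
    using e uv unfolding tangent_cone_def by auto
qed

text \<open>
  Near \<open>y\<close>, the only constraints that matter are the half-spaces with \<open>y\<close> on their boundary.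
\<close>

lemma polyhedron_tangent_cone:
  assumes "polyhedron P" "y \<in> P"
  shows "polyhedron (tangent_cone y P)"
proof -
  obtain F where F: "finite F" "P = \<Inter>F" "\<forall>h\<in>F. \<exists>a b. a \<noteq> 0 \<and> h = {x. a \<bullet> x \<le> b}"
    using assms(1) unfolding polyhedron_def by blast
  then obtain a b where ab: "\<And>h. h \<in> F \<Longrightarrow> a h \<noteq> 0 \<and> h = {x. a h \<bullet> x \<le> b h}" by metis
  let ?act = "{h \<in> F. a h \<bullet> y = b h}"
  have "tangent_cone y P = \<Inter>?act"
  proof (intro equalityI subsetI)
    fix z assume "z \<in> tangent_cone y P"
    then obtain e where e: "e > 0" "y + e *\<^sub>R (z - y) \<in> P" unfolding tangent_cone_def by blast
    show "z \<in> \<Inter>?act"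
    proof
      fix h assume h: "h \<in> ?act"
      then have "a h \<bullet> (y + e *\<^sub>R (z - y)) \<le> b h" using e F(2) ab by blast
      then have "e * (a h \<bullet> (z - y)) \<le> 0" using h by (simp add: inner_add_right)
      then have "a h \<bullet> (z - y) \<le> 0" using e by (simp add: mult_le_0_iff)
      then have "a h \<bullet> z \<le> b h" using h by (simp add: inner_diff_right)
      then show "z \<in> h" using h ab by blast
    qed
  next
    fix z assume z: "z \<in> \<Inter>?act"
    have "\<exists>e>0. \<forall>d. 0 < d \<and> d \<le> e \<longrightarrow> a h \<bullet> (y + d *\<^sub>R (z - y)) \<le> b h" if h: "h \<in> F" for h
    proof (cases "a h \<bullet> y = b h")
      case True
      then have "a h \<bullet> z \<le> b h" using z h ab by blast
      then have "a h \<bullet> (y + d *\<^sub>R (z - y)) \<le> b h" if "0 < d" for d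
        using True that by (simp add: inner_add_right inner_diff_right mult_nonneg_nonpos)
      then show ?thesis by (meson zero_less_one)
    next
      case False
      then have lt: "a h \<bullet> y < b h" using assms(2) F(2) h ab by (metis (mono_tags, lifting) InterD mem_Collect_eq order_le_less)
      let ?e = "(b h - a h \<bullet> y) / (\<bar>a h \<bullet> (z - y)\<bar> + 1)"
      have "a h \<bullet> (y + d *\<^sub>R (z - y)) \<le> b h" if d: "0 < d" "d \<le> ?e" for d
      proof -
        have "d * (a h \<bullet> (z - y)) \<le> d * (\<bar>a h \<bullet> (z - y)\<bar> + 1)" using d by simp
        also have "\<dots> \<le> b h - a h \<bullet> y" using d by (simp add: pos_le_divide_eq add_pos_nonneg)
        finally show ?thesis by (simp add: inner_add_right)
      qed
      moreover have "?e > 0" using lt by (simp add: add_pos_nonneg)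
      ultimately show ?thesis by blast
    qed
    then obtain e where e: "\<And>h. h \<in> F \<Longrightarrow> e h > 0"
      "\<And>h d. h \<in> F \<Longrightarrow> 0 < d \<Longrightarrow> d \<le> e h \<Longrightarrow> a h \<bullet> (y + d *\<^sub>R (z - y)) \<le> b h"
      by metis
    let ?d = "Min (insert 1 (e ` F))"
    have "?d > 0" using F(1) e(1) by simp
    moreover have "y + ?d *\<^sub>R (z - y) \<in> P"
    proof -
      have "y + ?d *\<^sub>R (z - y) \<in> h" if "h \<in> F" for h
        using e(2)[OF that \<open>?d > 0\<close>] that F(1) ab by (metis (mono_tags, lifting) Min_le finite.insertI finite_imageI imageI insertCI mem_Collect_eq)
      then show ?thesis using F(2) by blast
    qed
    ultimately show "z \<in> tangent_cone y P" unfolding tangent_cone_def by blast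
  qed
  moreover have "polyhedron (\<Inter>?act)"
    using F(1) ab by (intro polyhedron_Inter) (auto, metis polyhedron_halfspace_le)
  ultimately show ?thesis by simp
qed

text \<open>
  Shrinking towards \<open>y\<close> moves a segment of the cone into \<open>P\<close>, where the face property of \<open>F\<close>
  applies.
\<close>

lemma tangent_cone_face_of:
  assumes F: "F face_of P" "y \<in> F" and "convex P"
  shows "tangent_cone y F face_of tangent_cone y P"
  unfolding face_of_def
proof (intro conjI ballI impI)
  have FP: "F \<subseteq> P" "convex F" "y \<in> P"
    using F face_of_imp_subset face_of_imp_convex by blast+
  show "tangent_cone y F \<subseteq> tangent_cone y P" "convex (tangent_cone y F)"
    using FP F by (simp_all add: tangent_cone_mono convex_tangent_cone)
  fix a b x assume a: "a \<in> tangent_cone y P" and b: "b \<in> tangent_cone y P"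
    and x: "x \<in> tangent_cone y F" "x \<in> open_segment a b"
  obtain e where e: "e > 0" "y + e *\<^sub>R (a - y) \<in> P" "y + e *\<^sub>R (b - y) \<in> P"
    using tangent_cone_common_scale[OF assms(3) FP(3) assms(3) FP(3) a b] .
  obtain e' where e': "e' > 0" "y + e' *\<^sub>R (x - y) \<in> F" using x unfolding tangent_cone_def by blast
  let ?d = "min e e'" and ?h = "\<lambda>z. y + min e e' *\<^sub>R (z - y)"
  have h: "?h a \<in> P" "?h b \<in> P" "?h x \<in> F"
    using convex_shrink_towards[OF assms(3) FP(3) e(2), of ?d] convex_shrink_towards[OF assms(3) FP(3) e(3), of ?d]
      convex_shrink_towards[OF FP(2) F(2) e'(2), of ?d] e(1) e'(1) by auto
  obtain u where u: "0 < u" "u < 1" "x = (1 - u) *\<^sub>R a + u *\<^sub>R b" and "a \<noteq> b"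
    using x(2) by (auto simp: in_segment)
  have "?h x = (1 - u) *\<^sub>R ?h a + u *\<^sub>R ?h b"
    unfolding u(3) by (simp add: algebra_simps)
  moreover have "?h a \<noteq> ?h b" using e(1) e'(1) \<open>a \<noteq> b\<close> by auto
  ultimately have "?h x \<in> open_segment (?h a) (?h b)" using u unfolding in_segment by blast
  then have "?h a \<in> F" "?h b \<in> F" using face_ofD[OF F(1) _ h] by blast+
  then show "a \<in> tangent_cone y F" "b \<in> tangent_cone y F"
    using e(1) e'(1) unfolding tangent_cone_def by (metis (mono_tags, lifting) mem_Collect_eq min_less_iff_conj)+
qed

lemma tangent_cone_subset_affine_hull:
  assumes "y \<in> P"
  shows "tangent_cone y P \<subseteq> affine hull P"
proof
  fix z assume "z \<in> tangent_cone y P"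
  then obtain e where e: "e > 0" "y + e *\<^sub>R (z - y) \<in> P" unfolding tangent_cone_def by blast
  have "z = (1 - 1 / e) *\<^sub>R y + (1 / e) *\<^sub>R (y + e *\<^sub>R (z - y))"
    using e by (simp add: algebra_simps)
  moreover have "(1 - 1 / e) *\<^sub>R y + (1 / e) *\<^sub>R (y + e *\<^sub>R (z - y)) \<in> affine hull P"
    using e assms by (intro mem_affine) (auto simp: hull_inc)
  ultimately show "z \<in> affine hull P" by simp
qed

text \<open>
  Relatively interior points are those beyond which every segment can be prolonged. A prolongation
  inside \<open>P\<close> rescales about \<open>y\<close> to one inside the cone.
\<close>

lemma rel_interior_tangent_cone:
  assumes "convex P" "y \<in> P" "e > 0" "y + e *\<^sub>R (z - y) \<in> rel_interior P"
  shows "z \<in> rel_interior (tangent_cone y P)"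
proof -
  have ne: "tangent_cone y P \<noteq> {}" using assms unfolding tangent_cone_def by (auto intro: rel_interior_subset[THEN subsetD])
  have "\<exists>m'>1. (1 - m') *\<^sub>R p + m' *\<^sub>R z \<in> tangent_cone y P" if p: "p \<in> tangent_cone y P" for p
  proof -
    obtain c where c: "c > 0" "y + c *\<^sub>R (p - y) \<in> P" using p unfolding tangent_cone_def by blast
    define d where "d = min c e"
    have d: "0 < d" "d \<le> e" "y + d *\<^sub>R (p - y) \<in> P"
      using convex_shrink_towards[OF assms(1,2) c(2)] c(1) assms(3) by (auto simp: d_def)
    obtain m where m: "m > 1" "(1 - m) *\<^sub>R (y + d *\<^sub>R (p - y)) + m *\<^sub>R (y + e *\<^sub>R (z - y)) \<in> P"
      using convex_rel_interior_iff[OF assms(1), of "y + e *\<^sub>R (z - y)"] assms(2,4) d(3) by blast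
    \<comment> \<open>The extrapolated point is \<open>y + k ((1 - m') (p - y) + m' (z - y))\<close> for these values.\<close>
    define k where "k = m * e + (1 - m) * d"
    have "(m - 1) * d \<le> (m - 1) * e" using m(1) d(2) by (intro mult_left_mono) auto
    then have k: "k \<ge> e" by (simp add: k_def algebra_simps)
    then have k0: "k > 0" using assms(3) by simp
    have "k < m * e" using m(1) d(1) by (simp add: k_def mult_neg_pos)
    then have "m * e / k > 1" using k0 by simp
    moreover have "y + k *\<^sub>R ((1 - m * e / k) *\<^sub>R p + (m * e / k) *\<^sub>R z - y)
        = (1 - m) *\<^sub>R (y + d *\<^sub>R (p - y)) + m *\<^sub>R (y + e *\<^sub>R (z - y))"
    proof -
      have "k *\<^sub>R ((1 - m * e / k) *\<^sub>R p + (m * e / k) *\<^sub>R z - y) =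
          (k - m * e) *\<^sub>R p + (m * e) *\<^sub>R z - k *\<^sub>R y"
        using k0 by (simp add: scaleR_add_right scaleR_diff_right right_diff_distrib)
      then show ?thesis by (simp add: k_def algebra_simps)
    qed
    ultimately show ?thesis
      using m(2) k0 unfolding tangent_cone_def by (metis (mono_tags, lifting) mem_Collect_eq)
  qed
  then show ?thesis
    using convex_rel_interior_iff[OF convex_tangent_cone[OF assms(1,2)] ne] by blast
qed

section \<open>Slices of star-shaped complexes\<close>

text \<open>
  This is the hyperplane through \<open>x\<close> orthogonal to \<open>x - y\<close>. It meets each ray from \<open>y\<close> that starts
  towards \<open>x\<close> exactly once, and no other ray from \<open>y\<close>.
\<close>

definition radial_hyperplane :: "'a::euclidean_space \<Rightarrow> 'a \<Rightarrow> 'a set" where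
  "radial_hyperplane x y = {z. (x - y) \<bullet> z = (x - y) \<bullet> x}"

text \<open>
  The empty face is inserted because it need not be the slice of any face.
\<close>

definition slice_complex :: "'a::euclidean_space \<Rightarrow> 'a \<Rightarrow> 'a set set \<Rightarrow> 'a set set" where
  "slice_complex x y C = insert {} ((\<lambda>P. tangent_cone y P \<inter> radial_hyperplane x y) ` {P \<in> C. y \<in> P})"

lemma affine_radial_hyperplane: "affine (radial_hyperplane x y)"
  unfolding radial_hyperplane_def by (rule affine_hyperplane)

lemma center_in_radial_hyperplane: "x \<in> radial_hyperplane x y"
  by (simp add: radial_hyperplane_def)

lemma in_radial_hyperplane_iff:
  "z \<in> radial_hyperplane x y \<longleftrightarrow> (x - y) \<bullet> (z - y) = (x - y) \<bullet> (x - y)"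
  by (auto simp: radial_hyperplane_def inner_diff_right)

lemma notin_radial_hyperplane: "x \<noteq> y \<Longrightarrow> y \<notin> radial_hyperplane x y"
  by (simp add: in_radial_hyperplane_iff)

lemma slice_nonempty_iff:
  assumes "x \<noteq> y"
  shows "tangent_cone y P \<inter> radial_hyperplane x y \<noteq> {} \<longleftrightarrow> (\<exists>w\<in>P. (x - y) \<bullet> (w - y) > 0)"
proof
  assume "tangent_cone y P \<inter> radial_hyperplane x y \<noteq> {}"
  then obtain z e where z: "z \<in> radial_hyperplane x y" "e > 0" "y + e *\<^sub>R (z - y) \<in> P"
    by (auto simp: tangent_cone_def)
  then have "(x - y) \<bullet> (y + e *\<^sub>R (z - y) - y) > 0"
    using assms by (simp add: in_radial_hyperplane_iff)
  then show "\<exists>w\<in>P. (x - y) \<bullet> (w - y) > 0" using z(3) by blast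
next
  assume "\<exists>w\<in>P. (x - y) \<bullet> (w - y) > 0"
  then obtain w where w: "w \<in> P" "(x - y) \<bullet> (w - y) > 0" by blast
  define k where "k = ((x - y) \<bullet> (x - y)) / ((x - y) \<bullet> (w - y))"
  have k: "k > 0" using w(2) assms by (simp add: k_def)
  have "y + k *\<^sub>R (w - y) \<in> radial_hyperplane x y"
    using w(2) by (simp add: in_radial_hyperplane_iff k_def)
  moreover have "y + k *\<^sub>R (w - y) \<in> tangent_cone y P"
    unfolding tangent_cone_def using k w(1) by (auto intro!: exI[of _ "1 / k"])
  ultimately show "tangent_cone y P \<inter> radial_hyperplane x y \<noteq> {}" by blast
qed

text \<open>
  The only difficulty is to see that a face \<open>G\<close> of a slice is a slice itself. A relatively interior
  point of \<open>G\<close>, moved close to \<open>y\<close>, lies in the relative interior of a unique face of \<open>C\<close>, and \<open>G\<close> is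
  the slice of that face.
\<close>

lemma polyhedral_complex_slice:
  assumes C: "polyhedral_complex C" and xy: "x \<noteq> y"
  shows "polyhedral_complex (slice_complex x y C)"
proof -
  note D = polyhedral_complexD[OF C]
  let ?A = "radial_hyperplane x y"
  let ?s = "\<lambda>P. tangent_cone y P \<inter> ?A"
  have A: "convex ?A" "polyhedron ?A"
    using affine_radial_hyperplane affine_imp_convex affine_imp_polyhedron by blast+
  have face: "?s F face_of ?s P" if "P \<in> C" "F face_of P" "y \<in> F" for F P
    using that D(3) A(1) by (intro face_of_slice tangent_cone_face_of) auto
  have "finite (slice_complex x y C)"
    using D(1) by (simp add: slice_complex_def)
  moreover have "\<forall>Q\<in>slice_complex x y C. polyhedron Q"
    using D(2) A(2) by (auto simp: slice_complex_def polyhedron_tangent_cone)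
  moreover have "G \<in> slice_complex x y C" if Q: "Q \<in> slice_complex x y C" and G: "G face_of Q" for G Q
  proof (cases "G = {}")
    case False
    then obtain P where P: "P \<in> C" "y \<in> P" "Q = ?s P"
      using Q G by (auto simp: slice_complex_def)
    obtain z where z: "z \<in> rel_interior G"
      using False G face_of_imp_convex rel_interior_eq_empty by blast
    then have "z \<in> G" by (rule rel_interior_subset[THEN subsetD])
    then have zQ: "z \<in> tangent_cone y P" "z \<in> ?A" using G face_of_imp_subset P(3) by blast+
    then obtain e where e: "e > 0" "y + e *\<^sub>R (z - y) \<in> P" by (auto simp: tangent_cone_def)
    let ?w = "y + (e / 2) *\<^sub>R (z - y)"
    have "?w \<in> P" using convex_shrink_towards[OF D(3)[OF P(1)] P(2) e(2)] e(1) by simp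
    then obtain F where F: "F \<in> C" "F face_of P" "?w \<in> rel_interior F"
      using polyhedral_complex_minimal_face[OF C P(1)] by blast
    have "z \<noteq> y" using zQ(2) notin_radial_hyperplane[OF xy] by blast
    then have "?w \<in> open_segment y (y + e *\<^sub>R (z - y))"
      using e(1) by (auto simp: in_segment algebra_simps intro!: exI[of _ "1/2"])
    then have yF: "y \<in> F"
      using face_ofD[OF F(2) _ P(2) e(2)] F(3) rel_interior_subset by blast
    have "z \<in> rel_interior (tangent_cone y F)"
      using rel_interior_tangent_cone[OF D(3)[OF F(1)] yF _ F(3)] e(1) by simp
    then have "z \<in> rel_interior (?s F)"
      using convex_affine_rel_interior_Int[OF convex_tangent_cone[OF D(3)[OF F(1)] yF]
          affine_radial_hyperplane] zQ(2) by blast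
    moreover have "?s F face_of Q" using face[OF P(1) F(2) yF] P(3) by simp
    ultimately have "G = ?s F" using face_of_eq[OF G] z by blast
    then show ?thesis using F(1) yF by (auto simp: slice_complex_def)
  qed (simp add: slice_complex_def)
  moreover have "Q \<inter> Q' face_of Q" if Q: "Q \<in> slice_complex x y C" "Q' \<in> slice_complex x y C" for Q Q'
  proof (cases "Q = {} \<or> Q' = {}")
    case False
    obtain P where P1: "P \<in> C" "y \<in> P" "Q = ?s P"
      using Q(1) False unfolding slice_complex_def by blast
    obtain P' where P2: "P' \<in> C" "y \<in> P'" "Q' = ?s P'"
      using Q(2) False unfolding slice_complex_def by blast
    note P = P1 P2
    have "Q \<inter> Q' = ?s (P \<inter> P')" using P D(3) by (simp add: tangent_cone_Int) blast
    then show ?thesis using face[of P "P \<inter> P'"] P D(6) by simp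
  qed auto
  ultimately show ?thesis unfolding polyhedral_complex_def by blast
qed

lemma polyhedral_complex_locally_star:
  assumes C: "polyhedral_complex C"
  obtains d where "d > 0" "\<And>P z. P \<in> C \<Longrightarrow> z \<in> P \<Longrightarrow> dist y z < d \<Longrightarrow> y \<in> P"
proof -
  let ?U = "\<Union>{P \<in> C. y \<notin> P}"
  have "closed ?U" using polyhedral_complexD[OF C] by (intro closed_Union) auto
  moreover have "y \<in> - ?U" by auto
  ultimately obtain d where "d > 0" "ball y d \<subseteq> - ?U"
    by (meson open_Compl open_contains_ball)
  then show thesis using that[of d] by (auto simp: subset_iff)
qed

text \<open>
  A point of \<open>|C|\<close> close to \<open>y\<close> in the direction of \<open>z\<close>, moved towards \<open>x\<close>, stays in \<open>|C|\<close>; all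
  directions between \<open>z - y\<close> and \<open>x - y\<close> arise in this way.
\<close>

lemma tangent_cones_star_shaped:
  assumes C: "polyhedral_complex C"
    and star: "\<And>w. w \<in> \<Union>C \<Longrightarrow> closed_segment x w \<subseteq> \<Union>C"
    and P: "P \<in> C" "y \<in> P" "z \<in> tangent_cone y P" and t: "0 \<le> t" "t \<le> 1"
  shows "\<exists>Q\<in>C. y \<in> Q \<and> (1 - t) *\<^sub>R z + t *\<^sub>R x \<in> tangent_cone y Q"
proof -
  let ?q = "(1 - t) *\<^sub>R z + t *\<^sub>R x"
  obtain e where e: "e > 0" "y + e *\<^sub>R (z - y) \<in> P" using P(3) by (auto simp: tangent_cone_def)
  obtain d where d: "d > 0" "\<And>P z. P \<in> C \<Longrightarrow> z \<in> P \<Longrightarrow> dist y z < d \<Longrightarrow> y \<in> P"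
    using polyhedral_complex_locally_star[OF C] by blast
  define c where "c = min (1/2) (min (e / 2) (d / (norm (?q - y) + 1)))"
  have c: "0 < c" "c \<le> 1/2" "c \<le> e / 2" "c \<le> d / (norm (?q - y) + 1)"
    unfolding c_def using e(1) d(1)
    by (simp_all only: min.cobounded1 min_less_iff_conj) (auto simp: add_nonneg_pos min_le_iff_disj)
  have near: "dist y (y + c *\<^sub>R (?q - y)) < d"
  proof -
    have "norm (c *\<^sub>R v) < c * (norm v + 1)" for v :: 'a
      using c(1) by (simp add: distrib_left)
    then have "norm (c *\<^sub>R (?q - y)) < c * (norm (?q - y) + 1)" .
    also have "\<dots> \<le> d" using c(4) by (simp add: pos_le_divide_eq add_nonneg_pos)
    finally show ?thesis by (simp add: dist_norm)
  qed
  have ct: "c * t \<le> 1/2" using c(1,2) t mult_mono[of c "1/2" t 1] by simp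
  define k where "k = c * (1 - t) / (1 - c * t)"
  have "k \<le> 2 * c"
  proof -
    have "c * (1 - t) \<le> c * 1" using c(1) t by (intro mult_left_mono) auto
    also have "\<dots> \<le> 2 * c * (1 - c * t)" using ct c(1) mult_left_mono[of "1/2" "1 - c * t" "2 * c"] by simp
    finally show ?thesis using ct unfolding k_def by (simp add: pos_divide_le_eq)
  qed
  then have k: "0 \<le> k" "k \<le> e" using c t ct by (auto simp: k_def)
  have "y + k *\<^sub>R (z - y) \<in> P"
    using convex_shrink_towards[OF _ P(2) e(2)] k polyhedral_complexD(3)[OF C P(1)] by blast
  then have "closed_segment x (y + k *\<^sub>R (z - y)) \<subseteq> \<Union>C" using star P(1) by blast
  moreover have "y + c *\<^sub>R (?q - y) = (1 - (1 - c * t)) *\<^sub>R x + (1 - c * t) *\<^sub>R (y + k *\<^sub>R (z - y))"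
  proof -
    have "(1 - c * t) * k = c * (1 - t)" using ct by (simp add: k_def)
    then have "(1 - c * t) *\<^sub>R (y + k *\<^sub>R (z - y)) = (1 - c * t) *\<^sub>R y + (c * (1 - t)) *\<^sub>R (z - y)"
      by (simp only: scaleR_add_right scaleR_scaleR)
    then show ?thesis by (simp only:) (simp add: algebra_simps)
  qed
  then have "y + c *\<^sub>R (?q - y) \<in> closed_segment x (y + k *\<^sub>R (z - y))"
    unfolding in_segment using ct c(1) t by (intro exI[of _ "1 - c * t"]) auto
  ultimately obtain Q where "Q \<in> C" "y + c *\<^sub>R (?q - y) \<in> Q" by blast
  then show ?thesis
    using d(2)[OF _ _ near] c(1) unfolding tangent_cone_def by blast
qed

lemma slice_complex_star_shaped:
  assumes C: "polyhedral_complex C"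
    and star: "\<And>w. w \<in> \<Union>C \<Longrightarrow> closed_segment x w \<subseteq> \<Union>C"
    and y: "y \<in> \<Union>C"
  shows "x \<in> \<Union>(slice_complex x y C)"
    and "w \<in> \<Union>(slice_complex x y C) \<Longrightarrow> closed_segment x w \<subseteq> \<Union>(slice_complex x y C)"
proof -
  have U: "\<Union>(slice_complex x y C) = \<Union>(tangent_cone y ` {P \<in> C. y \<in> P}) \<inter> radial_hyperplane x y"
    by (auto simp: slice_complex_def)
  obtain P where P: "P \<in> C" "y \<in> P" using y by blast
  then have "y \<in> tangent_cone y P" by (auto simp: tangent_cone_def intro!: exI[of _ 1])
  then show "x \<in> \<Union>(slice_complex x y C)"
    using tangent_cones_star_shaped[OF C star P, of y 1] by (auto simp: U center_in_radial_hyperplane)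
  assume w: "w \<in> \<Union>(slice_complex x y C)"
  show "closed_segment x w \<subseteq> \<Union>(slice_complex x y C)"
  proof
    fix q assume q: "q \<in> closed_segment x w"
    then obtain t where t: "0 \<le> t" "t \<le> 1" "q = (1 - t) *\<^sub>R w + t *\<^sub>R x"
      by (subst (asm) closed_segment_commute) (auto simp: in_segment)
    obtain P' where P': "P' \<in> C" "y \<in> P'" "w \<in> tangent_cone y P'" using w by (auto simp: U)
    obtain Q where "Q \<in> C" "y \<in> Q" "q \<in> tangent_cone y Q"
      using tangent_cones_star_shaped[OF C star P' t(1,2)] t(3) by auto
    moreover have "q \<in> radial_hyperplane x y"
      using affine_radial_hyperplane w center_in_radial_hyperplane t
      by (auto simp: U intro!: mem_affine)
    ultimately show "q \<in> \<Union>(slice_complex x y C)" by (auto simp: U)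
  qed
qed

lemma aff_dim_slice_complex:
  assumes "x \<noteq> y" "y \<in> \<Union>C"
  shows "aff_dim (\<Union>(slice_complex x y C)) < aff_dim (\<Union>C)"
proof -
  let ?H = "affine hull \<Union>C"
  have "\<Union>(slice_complex x y C) \<subseteq> ?H \<inter> radial_hyperplane x y"
  proof
    fix z assume "z \<in> \<Union>(slice_complex x y C)"
    then obtain P where P: "P \<in> C" "y \<in> P" "z \<in> tangent_cone y P" "z \<in> radial_hyperplane x y"
      by (auto simp: slice_complex_def)
    have "affine hull P \<subseteq> ?H" using P(1) by (intro hull_mono) blast
    then show "z \<in> ?H \<inter> radial_hyperplane x y"
      using P tangent_cone_subset_affine_hull by blast
  qed
  then have "aff_dim (\<Union>(slice_complex x y C)) \<le> aff_dim (?H \<inter> radial_hyperplane x y)"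
    by (rule aff_dim_subset)
  also have "\<dots> < aff_dim ?H"
  proof (rule aff_dim_psubset)
    have eq: "affine hull (?H \<inter> radial_hyperplane x y) = ?H \<inter> radial_hyperplane x y"
      by (simp add: affine_hull_eq affine_Int affine_radial_hyperplane)
    have "y \<in> ?H" "y \<notin> radial_hyperplane x y"
      using assms by (simp_all add: hull_inc notin_radial_hyperplane)
    then show "affine hull (?H \<inter> radial_hyperplane x y) \<subset> affine hull ?H"
      unfolding hull_hull eq by auto
  qed
  finally show ?thesis by simp
qed

text \<open>
  A face is recovered from its slice: a relatively interior point of \<open>P\<close> on the side of \<open>x\<close> is
  visible from \<open>y\<close> in the slice of \<open>P\<close>, and near \<open>y\<close> it lies in every face whose slice contains
  that of \<open>P\<close>.
\<close>

lemma slice_subset_imp_subset: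
  assumes C: "polyhedral_complex C" and P: "P \<in> C" "y \<in> P" and Q: "Q \<in> C" "y \<in> Q"
    and w: "w \<in> P" "(x - y) \<bullet> (w - y) > 0"
    and sub: "tangent_cone y P \<inter> radial_hyperplane x y \<subseteq> tangent_cone y Q"
  shows "P \<subseteq> Q"
proof -
  have conv: "convex P" "convex Q" using polyhedral_complexD(3)[OF C] P Q by blast+
  obtain r where r: "r \<in> rel_interior P" using P conv rel_interior_eq_empty by blast
  define \<alpha> \<beta> where "\<alpha> = (x - y) \<bullet> (w - y)" and "\<beta> = (x - y) \<bullet> (r - y)"
  define \<delta> where "\<delta> = \<alpha> / (2 * (\<alpha> + \<bar>\<beta>\<bar>))"
  have \<alpha>: "\<alpha> > 0" using w by (simp add: \<alpha>_def)
  then have \<delta>: "0 < \<delta>" "\<delta> \<le> 1" by (auto simp: \<delta>_def add_pos_nonneg divide_le_eq)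
  define w' where "w' = w - \<delta> *\<^sub>R (w - r)"
  have w': "w' \<in> rel_interior P"
    unfolding w'_def by (rule rel_interior_convex_shrink[OF conv(1) r w(1) \<delta>])
  have pos: "(x - y) \<bullet> (w' - y) > 0"
  proof -
    have "\<alpha> + \<bar>\<beta>\<bar> > 0" using \<alpha> by (simp add: add_pos_nonneg)
    then have "\<delta> * (\<alpha> + \<bar>\<beta>\<bar>) = \<alpha> / 2" unfolding \<delta>_def by (metis less_irrefl nonzero_divide_mult_cancel_right times_divide_eq_left mult.commute mult_divide_mult_cancel_right divide_divide_eq_left' nonzero_mult_div_cancel_right)
    moreover have "(x - y) \<bullet> (w' - y) = \<alpha> - \<delta> * \<alpha> + \<delta> * \<beta>"
      by (simp add: w'_def \<alpha>_def \<beta>_def inner_diff_right algebra_simps)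
    moreover have "\<delta> * \<beta> \<ge> - (\<delta> * \<bar>\<beta>\<bar>)" using mult_left_mono[of "- \<bar>\<beta>\<bar>" \<beta> \<delta>] \<delta>(1) by simp
    ultimately show ?thesis using \<alpha> by (simp add: algebra_simps)
  qed
  have xy: "x \<noteq> y" using w by auto
  define k where "k = ((x - y) \<bullet> (x - y)) / ((x - y) \<bullet> (w' - y))"
  have k: "k > 0" using pos xy by (simp add: k_def)
  define z where "z = y + k *\<^sub>R (w' - y)"
  have "z \<in> radial_hyperplane x y"
    using pos by (simp add: in_radial_hyperplane_iff z_def k_def)
  moreover have "z \<in> tangent_cone y P"
    unfolding tangent_cone_def z_def using k rel_interior_subset[THEN subsetD, OF w']
    by (auto intro!: exI[of _ "1 / k"])
  ultimately have "z \<in> tangent_cone y Q" using sub by blast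
  then obtain e where "e > 0" "y + e *\<^sub>R (z - y) \<in> Q" by (auto simp: tangent_cone_def)
  then have e: "e * k > 0" "y + (e * k) *\<^sub>R (w' - y) \<in> Q" using k by (auto simp: z_def)
  define m where "m = min (e * k) 1"
  have m: "0 < m" "m \<le> 1" "m \<le> e * k" using e(1) by (auto simp: m_def)
  have "y + m *\<^sub>R (w' - y) \<in> Q" using convex_shrink_towards[OF conv(2) Q(2) e(2)] m by simp
  moreover have "y + m *\<^sub>R (w' - y) \<in> rel_interior P"
    using rel_interior_convex_shrink[OF conv(1) w' P(2) m(1,2)] by (simp add: algebra_simps)
  ultimately have "P \<inter> Q \<inter> rel_interior P \<noteq> {}" using rel_interior_subset by blast
  then show ?thesis
    using subset_of_face_of[OF polyhedral_complexD(6)[OF C P(1) Q(1)]] by blast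
qed

section \<open>The order complex of a star-shaped polyhedral complex\<close>

lemma closest_point_equality:
  assumes "closed P" "convex P" "y \<in> P" "Q \<subseteq> P" "closed Q" "Q \<noteq> {}"
    "dist x (closest_point Q x) = dist x (closest_point P x)"
  shows "closest_point Q x = closest_point P x"
proof (rule closest_point_unique)
  show "closest_point Q x \<in> P"
    using assms closest_point_in_set by blast
  show "\<forall>z\<in>P. dist x (closest_point Q x) \<le> dist x z"
    using closest_point_le[OF assms(1)] assms(7) by simp
qed (use assms in auto)

text \<open>
  The sweep is governed by the distance \<open>h\<close> to \<open>x\<close>, with ties broken by the dimension. If comparable
  faces have the same distance, then they also have the same closest point, so only the faces with a
  common closest point compete with each other.
\<close>

theorem star_shaped_order_complex_non_evasive:
  assumes "polyhedral_complex C" "x \<in> \<Union>C"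
    and "\<And>w. w \<in> \<Union>C \<Longrightarrow> closed_segment x w \<subseteq> \<Union>C"
  shows "abstract_non_evasive (order_complex (C - {{}}))"
  using assms
proof (induction "nat (aff_dim (\<Union>C))" arbitrary: C rule: less_induct)
  case less
  note C = less.prems(1)
  note D = polyhedral_complexD[OF C]
  define S where "S = C - {{}}"
  define m where "m = (\<lambda>P. closest_point P x)"
  define h where "h = (\<lambda>P. dist x (m P))"
  define R where "R = (\<lambda>P Q. h P < h Q \<or> h P = h Q \<and> aff_dim P < aff_dim Q)"
  \<comment> \<open>The faces that remain at the end of the sweep are those at distance 0.\<close>
  define T where "T = {P \<in> S. x \<in> P}"
  have S: "finite S" "\<And>P. P \<in> S \<Longrightarrow> P \<in> C \<and> P \<noteq> {}" using D(1) by (auto simp: S_def)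
  have m: "m P \<in> P" if "P \<in> S" for P
    using that S(2)[OF that] D(4) by (simp add: m_def closest_point_in_set)
  have h_le: "h P \<le> dist x z" if "P \<in> S" "z \<in> P" for P z
    unfolding h_def m_def using that S(2) D(4) by (intro closest_point_le) auto
  have h_mono: "h Q \<le> h P" if "P \<in> S" "Q \<in> S" "P \<subseteq> Q" for P Q
    using h_le[OF that(2), of "m P"] m[OF that(1)] that(3) by (auto simp: h_def)
  have m_eq: "m P = m Q" if "P \<in> S" "Q \<in> S" "P \<subseteq> Q" "h P = h Q" for P Q
    unfolding m_def using that S(2) D(3,4)
    by (intro closest_point_equality[of Q "m Q"]) (auto simp: h_def m_def m[unfolded m_def])
  have dim_less: "aff_dim P < aff_dim Q" if "P \<in> S" "Q \<in> S" "P \<subset> Q" for P Q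
  proof -
    have "Q \<inter> P = P" using that(3) by blast
    then have "P face_of Q" using D(6)[of Q P] S(2) that by simp
    then show ?thesis using face_of_aff_dim_lt[of Q P] D(3) S(2) that by blast
  qed
  have T0: "P \<in> T \<longleftrightarrow> h P = 0" if "P \<in> S" for P
    using that h_le[OF that, of x] m[OF that] by (auto simp: T_def h_def)
  have "abstract_non_evasive (order_complex S)"
  proof (rule abstract_non_evasive_order_complex_sweep[where R = R and T = T])
    obtain P where "P \<in> C" "x \<in> P" using less.prems(2) by blast
    then obtain F where F: "F \<in> C" "x \<in> rel_interior F"
      using polyhedral_complex_minimal_face[OF C] by blast
    then have "F \<in> T" using rel_interior_subset by (auto simp: T_def S_def)
    moreover have "F \<subseteq> P" if "P \<in> T" for P
      using polyhedral_complex_face_subset[OF C F(1) _ F(2)] that S(2) by (auto simp: T_def)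
    ultimately show "abstract_non_evasive (order_complex T)"
      using S(1) by (intro abstract_non_evasive_order_complex_cone[of T F]) (auto simp: T_def)
  next
    fix P assume P: "P \<in> S - T"
    define y where "y = m P"
    let ?L = "{Q \<in> comparable_elements P S. R Q P}"
    have PS: "P \<in> S" "P \<in> C" using P S(2) by blast+
    have yP: "y \<in> P" using m[OF PS(1)] by (simp add: y_def)
    have hP: "h P = dist x y" by (simp add: h_def y_def)
    have xy: "x \<noteq> y" using T0[OF PS(1)] P hP by auto
    have fin: "finite ?L" using S(1) by (simp add: comparable_elements_def)
    have L: "(Q \<subset> P \<and> m Q = y) \<or> (P \<subset> Q \<and> h Q < h P)" if "Q \<in> ?L" for Q
    proof -
      have Q: "Q \<in> S" "Q \<subset> P \<or> P \<subset> Q" "R Q P" using that by (auto simp: comparable_elements_def)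
      show ?thesis
      proof (cases "Q \<subset> P")
        case True
        then have "h Q = h P" using Q(1,3) PS(1) h_mono[of Q P] by (auto simp: R_def)
        then show ?thesis using True m_eq[of Q P] Q(1) PS(1) by (auto simp: y_def)
      next
        case False
        then have "P \<subset> Q" using Q(2) by blast
        then show ?thesis using Q(1,3) dim_less[OF PS(1) Q(1)] by (auto simp: R_def)
      qed
    qed
    obtain F where F: "F \<in> C" "F face_of P" "y \<in> rel_interior F"
      using polyhedral_complex_minimal_face[OF C PS(2) yP] by blast
    have F_min: "F \<subseteq> Q" if "Q \<in> C" "y \<in> Q" for Q
      using polyhedral_complex_face_subset[OF C F(1) that(1) F(3) that(2)] .
    have yF: "y \<in> F" using F(3) rel_interior_subset by blast
    show "abstract_non_evasive (order_complex ?L)"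
    proof (cases "F = P")
      case False
      \<comment> \<open>All faces of the link contain \<open>y\<close> or \<open>P\<close>, so the link is a cone with apex \<open>F\<close>.\<close>
      then have FP: "F \<subset> P" using F_min[OF PS(2) yP] by blast
      have FS: "F \<in> S" using F(1) yF by (auto simp: S_def)
      have "h F = h P"
        using h_le[OF FS yF] h_mono[OF FS PS(1)] FP hP by auto
      then have "F \<in> ?L"
        using FS FP dim_less[OF FS PS(1) FP] by (simp add: comparable_elements_def R_def)
      moreover have "F \<subseteq> Q" if "Q \<in> ?L" for Q
        using L[OF that]
      proof
        assume "Q \<subset> P \<and> m Q = y"
        moreover have "Q \<in> S" using that by (simp add: comparable_elements_def)
        ultimately show ?thesis using F_min[of Q] m[of Q] S(2) by auto
      qed (use FP in blast)
      ultimately show ?thesis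
        using fin by (intro abstract_non_evasive_order_complex_cone[of _ F]) auto
    next
      case True
      \<comment> \<open>No face below \<open>P\<close> is left. Those above \<open>P\<close> are left if they reach closer to \<open>x\<close>.\<close>
      let ?A = "radial_hyperplane x y"
      let ?s = "\<lambda>Q. tangent_cone y Q \<inter> ?A"
      have towards: "h Q < h P \<longleftrightarrow> (\<exists>w\<in>Q. (x - y) \<bullet> (w - y) > 0)" if Q: "Q \<in> C" "y \<in> Q" for Q
      proof
        have QS: "Q \<in> S" using Q by (auto simp: S_def)
        {
          assume lt: "h Q < h P"
          have "dist x (m Q) < dist x y" using lt hP by (simp add: h_def)
          then have "norm (x - m Q) ^ 2 < norm (x - y) ^ 2" by (simp add: dist_norm power_strict_mono)
          moreover have "norm (x - m Q) ^ 2 = norm (x - y) ^ 2 + norm (m Q - y) ^ 2 - 2 * ((x - y) \<bullet> (m Q - y))"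
            by (simp add: power2_norm_eq_inner inner_diff_left inner_diff_right inner_commute algebra_simps)
          moreover have "norm (m Q - y) ^ 2 \<ge> 0" by simp
          ultimately have "(x - y) \<bullet> (m Q - y) > 0" by linarith
          then show "\<exists>w\<in>Q. (x - y) \<bullet> (w - y) > 0" using m[OF QS] by blast
        next
          assume "\<exists>w\<in>Q. (x - y) \<bullet> (w - y) > 0"
          then obtain w where w: "w \<in> Q" "(x - y) \<bullet> (w - y) > 0" by blast
          have "m Q \<noteq> y"
            using closest_point_dot[of Q w x] w D(3,4)[OF Q(1)] by (auto simp: m_def)
          moreover have "h Q \<le> h P" using h_le[OF QS Q(2)] hP by simp
          moreover have "P \<subseteq> Q" using F_min[OF Q] True by simp
          ultimately show "h Q < h P"
            using m_eq[OF PS(1) QS] by (force simp: y_def)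
        }
      qed
      have Leq: "?L = {Q \<in> C. y \<in> Q \<and> ?s Q \<noteq> {}}"
      proof (intro equalityI subsetI)
        fix Q assume Q: "Q \<in> ?L"
        then have QS: "Q \<in> S" by (simp add: comparable_elements_def)
        then have QC: "Q \<in> C" using S(2) by blast
        have "\<not> (Q \<subset> P \<and> m Q = y)"
        proof
          assume *: "Q \<subset> P \<and> m Q = y"
          then have "P \<subseteq> Q" using F_min[OF QC] m[OF QS] True by simp
          then show False using * by blast
        qed
        then have PQ: "P \<subset> Q" "h Q < h P" using L[OF Q] by blast+
        then have "y \<in> Q" using yP by blast
        then show "Q \<in> {Q \<in> C. y \<in> Q \<and> ?s Q \<noteq> {}}"
          using towards[OF QC] PQ(2) slice_nonempty_iff[OF xy, of Q] QC by blast
      next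
        fix Q assume "Q \<in> {Q \<in> C. y \<in> Q \<and> ?s Q \<noteq> {}}"
        then have Q: "Q \<in> C" "y \<in> Q" and ne: "?s Q \<noteq> {}" by blast+
        then have "h Q < h P" using towards[OF Q] slice_nonempty_iff[OF xy, of Q] by blast
        moreover have "P \<subseteq> Q" using F_min[OF Q] True by simp
        ultimately show "Q \<in> ?L" using Q by (auto simp: comparable_elements_def R_def S_def)
      qed
      have "abstract_non_evasive (order_complex (slice_complex x y C - {{}}))"
      proof (rule less.hyps)
        have y: "y \<in> \<Union>C" using PS(2) yP by blast
        note star = slice_complex_star_shaped[OF C less.prems(3) y]
        have "aff_dim (\<Union>(slice_complex x y C)) \<ge> 0"
          using star(1) by (metis aff_dim_negative_iff empty_iff leI)
        then show "nat (aff_dim (\<Union>(slice_complex x y C))) < nat (aff_dim (\<Union>C))"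
          using aff_dim_slice_complex[OF xy y] by simp
        show "polyhedral_complex (slice_complex x y C)" by (rule polyhedral_complex_slice[OF C xy])
        show "x \<in> \<Union>(slice_complex x y C)" by (rule star(1))
        show "closed_segment x w \<subseteq> \<Union>(slice_complex x y C)" if "w \<in> \<Union>(slice_complex x y C)" for w
          using star(2) that by blast
      qed
      also have "slice_complex x y C - {{}} = ?s ` ?L"
        unfolding Leq slice_complex_def by blast
      finally have ne: "abstract_non_evasive (order_complex (?s ` ?L))" .
      show ?thesis
      proof (rule abstract_non_evasive_order_complex_iso[OF ne])
        fix Q Q' assume QQ: "Q \<in> ?L" "Q' \<in> ?L"
        then have Q: "Q \<in> C" "y \<in> Q" "Q' \<in> C" "y \<in> Q'" "?s Q \<noteq> {}" unfolding Leq by blast+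
        then obtain w where w: "w \<in> Q" "(x - y) \<bullet> (w - y) > 0"
          using slice_nonempty_iff[OF xy, of Q] by blast
        assume "?s Q \<subseteq> ?s Q'"
        then show "Q \<subseteq> Q'" using slice_subset_imp_subset[OF C Q(1-4) w] by blast
      next
        fix Q Q' :: "'a set" assume "Q \<subseteq> Q'"
        then show "?s Q \<subseteq> ?s Q'" using tangent_cone_mono by blast
      qed
    qed
  next
    fix P Q assume "P \<in> T" "Q \<in> S - T"
    then show "R P Q" using T0[of P] T0[of Q] by (auto simp: R_def T_def h_def)
  next
    fix P Q assume "P \<in> S" "Q \<in> S" "P \<subset> Q"
    then show "R P Q \<or> R Q P" using dim_less[of P Q] h_mono[of P Q] by (force simp: R_def)
  qed (use S(1) in \<open>auto simp: T_def R_def\<close>)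
  then show ?case by (simp add: S_def)
qed

section \<open>Geometric realisations of abstract complexes\<close>

text \<open>
  These are the families of vertex sets of geometric simplicial complexes. That two simplices meet
  in a common face is expressed through their vertices.
\<close>

definition geometric_scheme :: "'a::euclidean_space set set \<Rightarrow> bool" where
  "geometric_scheme X \<longleftrightarrow>
     abstract_complex X \<and> (\<forall>s\<in>X. \<not> affine_dependent s) \<and>
     (\<forall>s\<in>X. \<forall>t\<in>X. convex hull s \<inter> convex hull t \<subseteq> convex hull (s \<inter> t))"

lemma geometric_scheme_hull_subset:
  assumes X: "geometric_scheme X" and st: "s \<in> X" "t \<in> X" and sub: "convex hull s \<subseteq> convex hull t"
  shows "s \<subseteq> t"
proof
  fix v assume v: "v \<in> s"
  have "convex hull s \<subseteq> convex hull (s \<inter> t)"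
    using X st sub unfolding geometric_scheme_def by blast
  then have v': "v \<in> convex hull (s \<inter> t)" using hull_inc[OF v] by blast
  show "v \<in> t"
  proof (rule ccontr)
    assume "v \<notin> t"
    then have "convex hull (s \<inter> t) \<subseteq> affine hull (s - {v})"
      by (intro order_trans[OF convex_hull_subset_affine_hull] hull_mono) auto
    then have "affine_dependent s" using v v' unfolding affine_dependent_def by blast
    then show False using X st unfolding geometric_scheme_def by blast
  qed
qed

lemma geometric_scheme_hull_mono_iff:
  assumes "geometric_scheme X" "s \<in> X" "t \<in> X"
  shows "convex hull s \<subseteq> convex hull t \<longleftrightarrow> s \<subseteq> t" "convex hull s = convex hull t \<longleftrightarrow> s = t"
    "convex hull s \<subset> convex hull t \<longleftrightarrow> s \<subset> t"
  using geometric_scheme_hull_subset[OF assms] geometric_scheme_hull_subset[OF assms(1,3,2)]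
    hull_mono[of s t convex] by auto

lemma geometric_scheme_vertex_in_hull:
  assumes "geometric_scheme X" "{v} \<in> X" "s \<in> X"
  shows "v \<in> convex hull s \<longleftrightarrow> v \<in> s"
  using geometric_scheme_hull_mono_iff(1)[OF assms] by simp

text \<open>
  The vertex set of a simplex is recovered from the simplex as its set of extreme points; hence the
  geometric link has no faces beyond those of the combinatorial one.
\<close>

lemma link_hull_image:
  assumes X: "geometric_scheme X" and Y: "Y \<subseteq> X" and v: "{v} \<in> Y"
  shows "link v ((hull) convex ` Y) = (hull) convex ` vertex_link v Y"
proof (intro equalityI subsetI)
  note vin = geometric_scheme_vertex_in_hull[OF X subsetD[OF Y v]]
  fix F
  {
    assume "F \<in> link v ((hull) convex ` Y)"
    then obtain s t where st: "s \<in> Y" "F = convex hull s" "v \<notin> convex hull s" "t \<in> Y"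
      "convex hull (insert v (convex hull s)) = convex hull t"
      by (auto simp: link_def)
    then have stX: "s \<in> X" "t \<in> X" using Y by blast+
    have t: "convex hull t = convex hull (insert v s)" using st(5) by (simp add: hull_insert[symmetric])
    have "t \<subseteq> insert v s"
    proof
      fix x assume "x \<in> t"
      then have "x extreme_point_of (convex hull t)"
        using X stX(2) extreme_point_of_convex_hull_affine_independent
        unfolding geometric_scheme_def by blast
      then show "x \<in> insert v s" unfolding t by (rule extreme_point_of_convex_hull)
    qed
    moreover have "s \<subseteq> t"
      using geometric_scheme_hull_subset[OF X stX] t hull_mono[of s "insert v s" convex] by blast
    moreover have "v \<in> t"
      using vin[OF stX(2)] t hull_inc[of v "insert v s" convex] by blast
    ultimately have "t = insert v s" by blast
    then show "F \<in> (hull) convex ` vertex_link v Y"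
      using st vin[OF stX(1)] by (auto simp: vertex_link_def)
  next
    assume "F \<in> (hull) convex ` vertex_link v Y"
    then obtain s where s: "s \<in> Y" "v \<notin> s" "insert v s \<in> Y" "F = convex hull s"
      by (auto simp: vertex_link_def)
    moreover have "convex hull (insert v F) = convex hull (insert v s)"
      using s(4) by (simp add: hull_insert[symmetric])
    ultimately show "F \<in> link v ((hull) convex ` Y)"
      using vin[of s] Y by (auto simp: link_def)
  }
qed

lemma deletion_hull_image:
  assumes "geometric_scheme X" "Y \<subseteq> X" "{v} \<in> Y"
  shows "deletion v ((hull) convex ` Y) = (hull) convex ` vertex_deletion v Y"
proof -
  have "v \<in> convex hull s \<longleftrightarrow> v \<in> s" if "s \<in> Y" for s
    using geometric_scheme_vertex_in_hull[of X v s] assms that by blast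
  then show ?thesis unfolding deletion_def vertex_deletion_def by blast
qed

lemma abstract_non_evasive_imp_non_evasive:
  assumes "abstract_non_evasive Y" "geometric_scheme X" "Y \<subseteq> X"
  shows "non_evasive ((hull) convex ` Y)"
  using assms
proof (induction rule: abstract_non_evasive.induct)
  case (point v)
  then show ?case using non_evasive.point by simp
next
  case (step v Y)
  obtain w where "{w} \<in> vertex_link v Y" using abstract_non_evasive_has_vertex[OF step.hyps(2)] by blast
  then have w: "v \<noteq> w" "{v, w} \<in> Y" by (auto simp: vertex_link_def)
  have "finite Y"
    using step.prems by (auto simp: geometric_scheme_def abstract_complex_def intro: finite_subset)
  moreover have "aff_dim (convex hull {v, w}) = 1"
    unfolding aff_dim_convex_hull using w(1) by (simp add: aff_dim_2)
  moreover have "aff_dim (convex hull {v, w}) \<in> aff_dim ` (hull) convex ` Y" using w(2) by blast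
  ultimately have "complex_dim ((hull) convex ` Y) > 0"
    unfolding complex_dim_def by (metis Max_ge finite_imageI less_le_trans zero_less_one)
  moreover have "{v} \<in> (hull) convex ` Y" using imageI[OF step.hyps(1), of "(hull) convex"] by simp
  moreover have "vertex_link v Y \<subseteq> X" "vertex_deletion v Y \<subseteq> X"
    using step.prems(2) unfolding vertex_link_def vertex_deletion_def by blast+
  then have "non_evasive (link v ((hull) convex ` Y))" "non_evasive (deletion v ((hull) convex ` Y))"
    using step.IH step.prems(1) link_hull_image[OF step.prems step.hyps(1)]
      deletion_hull_image[OF step.prems step.hyps(1)] by metis+
  ultimately show ?case by (rule non_evasive.step)
qed

lemma elementary_collapse_hull_image:
  assumes "elementary_collapse Y Z" "geometric_scheme X" "Y \<subseteq> X"
  shows "elementary_collapse ((hull) convex ` Y) ((hull) convex ` Z)"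
proof -
  obtain \<sigma> \<tau> where st: "\<sigma> \<in> Y" "\<sigma> \<noteq> {}" "{\<rho> \<in> Y. \<sigma> \<subset> \<rho>} = {\<tau>}" "Z = Y - {\<sigma>, \<tau>}"
    using assms(1) unfolding elementary_collapse_def by blast
  then have \<tau>: "\<tau> \<in> Y" "\<sigma> \<subset> \<tau>" by auto
  have sub: "convex hull \<sigma> \<subset> convex hull \<rho> \<longleftrightarrow> \<sigma> \<subset> \<rho>" if "\<rho> \<in> Y" for \<rho>
    by (rule geometric_scheme_hull_mono_iff(3)[OF assms(2) subsetD[OF assms(3) st(1)] subsetD[OF assms(3) that]])
  have up: "{\<rho> \<in> (hull) convex ` Y. convex hull \<sigma> \<subset> \<rho>} = {convex hull \<tau>}"
  proof -
    have "{\<rho> \<in> (hull) convex ` Y. convex hull \<sigma> \<subset> \<rho>} = (hull) convex ` {\<rho> \<in> Y. \<sigma> \<subset> \<rho>}"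
      using sub by blast
    then show ?thesis using st(3) by simp
  qed
  have "inj_on ((hull) convex) Y"
    using geometric_scheme_hull_mono_iff(2)[OF assms(2)] assms(3) by (meson inj_onI subsetD)
  then have diff: "(hull) convex ` Z = (hull) convex ` Y - {convex hull \<sigma>, convex hull \<tau>}"
    unfolding st(4) using inj_on_image_set_diff[of "(hull) convex" Y Y "{\<sigma>, \<tau>}"] st(1) \<tau>(1) by simp
  show ?thesis
    unfolding elementary_collapse_def
  proof (intro exI conjI)
    show "convex hull \<sigma> \<in> (hull) convex ` Y" using st(1) by blast
    show "convex hull \<sigma> \<noteq> {}" using st(2) by simp
  qed (rule up diff)+
qed

lemma collapsible_hull_image:
  assumes "geometric_scheme X" "collapsible X"
  shows "collapsible ((hull) convex ` X)"
proof -
  obtain v where "elementary_collapse\<^sup>*\<^sup>* X {{}, {v}}" using assms(2) unfolding collapsible_def by blast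
  moreover have "Y \<subseteq> X \<and> elementary_collapse\<^sup>*\<^sup>* ((hull) convex ` X) ((hull) convex ` Y)"
    if "elementary_collapse\<^sup>*\<^sup>* X Y" for Y
    using that
  proof (induction rule: rtranclp_induct)
    case (step Y Z)
    then show ?case
      using elementary_collapse_hull_image[OF step.hyps(2) assms(1)] elementary_collapse_subset[OF step.hyps(2)]
      by (meson order_trans rtranclp.rtrancl_into_rtrancl)
  qed simp
  ultimately have "elementary_collapse\<^sup>*\<^sup>* ((hull) convex ` X) ((hull) convex ` {{}, {v}})" by blast
  then show ?thesis unfolding collapsible_def by auto
qed

lemma geometric_scheme_non_evasive:
  assumes "geometric_scheme X" "abstract_non_evasive X"
  shows "non_evasive ((hull) convex ` X) \<and> collapsible ((hull) convex ` X)"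
  using abstract_non_evasive_imp_non_evasive[OF assms(2,1)] collapsible_hull_image[OF assms(1)]
    abstract_non_evasive_imp_collapsible[OF assms(2)] assms(1)
  by (simp add: geometric_scheme_def)

lemma geometric_scheme_simplicial_complex:
  assumes "geometric_scheme X"
  shows "simplicial_complex ((hull) convex ` X)"
proof -
  note mono = geometric_scheme_hull_mono_iff[OF assms]
  have X: "abstract_complex X" "\<And>s. s \<in> X \<Longrightarrow> \<not> affine_dependent s"
    "\<And>s t. s \<in> X \<Longrightarrow> t \<in> X \<Longrightarrow> convex hull s \<inter> convex hull t \<subseteq> convex hull (s \<inter> t)"
    using assms unfolding geometric_scheme_def by blast+
  have sub: "t \<in> X" if "s \<in> X" "t \<subseteq> s" for s t
    using X(1) that unfolding abstract_complex_def by blast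
  have faces: "F face_of convex hull s \<longleftrightarrow> (\<exists>t\<subseteq>s. F = convex hull t)" if "s \<in> X" for F s
    using face_of_convex_hull_affine_independent[OF X(2)[OF that]] .
  show ?thesis
    unfolding simplicial_complex_def
  proof (intro conjI ballI allI impI)
    show "finite ((hull) convex ` X)" using X(1) by (simp add: abstract_complex_def)
    fix F assume "F \<in> (hull) convex ` X"
    then obtain s where s: "s \<in> X" "F = convex hull s" by blast
    then show "\<exists>n. n simplex F" unfolding simplex_def using X(2) by (metis diff_add_cancel)
  next
    fix F G assume "G \<in> (hull) convex ` X \<and> F face_of G"
    then show "F \<in> (hull) convex ` X" using faces sub by blast
  next
    fix F G assume "F \<in> (hull) convex ` X \<and> G \<in> (hull) convex ` X"
    then obtain s t where st: "s \<in> X" "t \<in> X" "F = convex hull s" "G = convex hull t" by blast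
    have "convex hull s \<inter> convex hull t = convex hull (s \<inter> t)"
      using X(3)[OF st(1,2)] hull_mono[of "s \<inter> t" s convex] hull_mono[of "s \<inter> t" t convex] by blast
    then show "F \<inter> G face_of F" using faces[OF st(1)] st(3,4) by auto
  qed
qed

text \<open>
  The intersection of two simplices is a face of both, hence the hull of a set of vertices of each;
  since extreme points determine the vertices, it is the same set for both.
\<close>

lemma simplicial_complex_geometric_scheme:
  assumes K: "simplicial_complex K"
  obtains X where "geometric_scheme X" "K = (hull) convex ` X"
proof
  let ?X = "{s. \<not> affine_dependent s \<and> convex hull s \<in> K}"
  have fin: "finite K" and simp: "\<And>F. F \<in> K \<Longrightarrow> \<exists>n. n simplex F"
    and face: "\<And>F G. G \<in> K \<Longrightarrow> F face_of G \<Longrightarrow> F \<in> K"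
    and int: "\<And>F G. F \<in> K \<Longrightarrow> G \<in> K \<Longrightarrow> F \<inter> G face_of F"
    using K unfolding simplicial_complex_def by blast+
  show "K = (hull) convex ` ?X"
    using simp unfolding simplex_def by blast
  have ext: "s = {x. x extreme_point_of (convex hull s)}" if "\<not> affine_dependent s" for s :: "'a set"
    using extreme_point_of_convex_hull_affine_independent[OF that] by blast
  have "?X \<subseteq> (\<lambda>F. {x. x extreme_point_of F}) ` K"
    using ext by blast
  then have "finite ?X" using fin by (meson finite_imageI finite_subset)
  moreover have "t \<in> ?X" if s: "s \<in> ?X" "t \<subseteq> s" for s t
    using s face affine_independent_subset[of s t] face_of_convex_hull_affine_independent[of s "convex hull t"]
    by blast
  ultimately have "abstract_complex ?X"
    unfolding abstract_complex_def using aff_independent_finite by blast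
  moreover have "convex hull s \<inter> convex hull t \<subseteq> convex hull (s \<inter> t)" if st: "s \<in> ?X" "t \<in> ?X" for s t
  proof -
    let ?I = "convex hull s \<inter> convex hull t"
    have "?I face_of convex hull s" "?I face_of convex hull t"
      using st int[of "convex hull s" "convex hull t"] int[of "convex hull t" "convex hull s"]
      by (simp_all add: Int_commute)
    then obtain c d where cd: "c \<subseteq> s" "?I = convex hull c" "d \<subseteq> t" "?I = convex hull d"
      using st face_of_convex_hull_affine_independent[of s] face_of_convex_hull_affine_independent[of t]
      by auto
    then have "\<not> affine_dependent c" "\<not> affine_dependent d"
      using st affine_independent_subset by blast+
    then have "c = d" using ext cd(2,4) by metis
    then show ?thesis using cd hull_mono[of c "s \<inter> t" convex] by blast
  qed
  ultimately show "geometric_scheme ?X" unfolding geometric_scheme_def by blast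
qed

section \<open>Derived subdivisions\<close>

lemma polytopal_imp_polyhedral_complex: "polytopal_complex C \<Longrightarrow> polyhedral_complex C"
  unfolding polytopal_complex_def polyhedral_complex_def by (auto simp: polytope_imp_polyhedron)

lemma simplicial_imp_polytopal_complex:
  assumes "simplicial_complex K"
  shows "polytopal_complex K"
proof -
  have "F \<inter> G face_of F \<and> F \<inter> G face_of G" if "F \<in> K" "G \<in> K" for F G
    using assms that unfolding simplicial_complex_def by (metis Int_commute)
  then show ?thesis
    using assms simplex_imp_polytope unfolding simplicial_complex_def polytopal_complex_def by metis
qed

lemma finite_chain_top:
  assumes "c \<in> order_complex S" "finite S" "c \<noteq> {}"
  obtains G where "G \<in> c" "\<And>F. F \<in> c \<Longrightarrow> F \<subseteq> G"
proof -
  have "finite c" using assms finite_subset unfolding order_complex_def subset_chain_def by blast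
  then obtain G where "G \<in> c" "\<forall>F\<in>c. G \<subseteq> F \<longrightarrow> G = F" using finite_has_maximal[of c] assms(3) by auto
  moreover have "\<forall>F\<in>c. \<forall>H\<in>c. F \<subseteq> H \<or> H \<subseteq> F"
    using assms(1) by (simp add: order_complex_def subset_chain_def)
  ultimately show thesis using that by (metis order_refl)
qed

context
  fixes C :: "'a::euclidean_space set set" and p :: "'a set \<Rightarrow> 'a"
  assumes C: "polyhedral_complex C" and p: "\<And>F. F \<in> C - {{}} \<Longrightarrow> p F \<in> rel_interior F"
begin

lemma finite_nonempty_faces: "finite (C - {{}})"
  using polyhedral_complexD(1)[OF C] by simp

lemma chain_member: "c \<in> order_complex (C - {{}}) \<Longrightarrow> F \<in> c \<Longrightarrow> F \<in> C \<and> F \<noteq> {} \<and> p F \<in> rel_interior F \<and> p F \<in> F"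
  using p rel_interior_subset unfolding order_complex_def subset_chain_def by blast

lemma hull_chain_subset:
  assumes "c \<in> order_complex (C - {{}})" "G \<in> C" "\<And>F. F \<in> c \<Longrightarrow> F \<subseteq> G"
  shows "convex hull (p ` c) \<subseteq> G"
  using assms chain_member polyhedral_complexD(3)[OF C] by (intro hull_minimal) blast+

text \<open>
  The facet opposite to \<open>p G\<close> lies in a proper face of \<open>G\<close>, and hence outside the relative interior.
  All other points of the simplex are \<open>p G\<close> or lie strictly between \<open>p G\<close> and this facet.
\<close>

lemma hull_chain_decompose:
  assumes c: "c \<in> order_complex (C - {{}})" and G: "G \<in> c" "\<And>F. F \<in> c \<Longrightarrow> F \<subseteq> G"
    and z: "z \<in> convex hull (p ` c)" "z \<notin> convex hull (p ` (c - {G}))"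
  shows "z \<in> rel_interior G"
    and "z = p G \<or> (\<exists>s q. 0 < s \<and> s < 1 \<and> q \<in> convex hull (p ` (c - {G})) \<and> q \<in> G \<and> q \<notin> rel_interior G \<and>
      z - p G = s *\<^sub>R (q - p G))"
proof -
  note D = polyhedral_complexD[OF C]
  have GC: "G \<in> C" "p G \<in> rel_interior G" using chain_member[OF c G(1)] by blast+
  let ?d = "c - {G}"
  have d: "?d \<in> order_complex (C - {{}})" using order_complex_subset[OF c] by blast
  have "p ` c = insert (p G) (p ` ?d)" using G(1) by blast
  then have ins: "z \<in> convex hull (insert (p G) (p ` ?d))" using z(1) by simp
  have "z = p G \<or> (\<exists>s q. 0 < s \<and> s < 1 \<and> q \<in> convex hull (p ` ?d) \<and> z - p G = s *\<^sub>R (q - p G))"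
  proof (cases "?d = {}")
    case False
    then obtain u v q where uv: "0 \<le> u" "0 \<le> v" "u + v = 1" "q \<in> convex hull (p ` ?d)" "z = u *\<^sub>R p G + v *\<^sub>R q"
      using ins convex_hull_insert[of "p ` ?d" "p G"] by auto
    then have "z - p G = v *\<^sub>R (q - p G)" by (simp add: algebra_simps flip: scaleR_add_left)
    moreover have "v \<noteq> 1" using uv z(2) by auto
    then have "v < 1" using uv by simp
    ultimately show ?thesis using uv by (cases "v = 0") fastforce+
  next
    case True
    then have "z \<in> convex hull {p G}" using ins by (simp only: image_empty)
    then show ?thesis by simp
  qed
  moreover have "q \<in> G \<and> q \<notin> rel_interior G" if q: "q \<in> convex hull (p ` ?d)" for q
  proof -
    have "?d \<noteq> {}"
    proof
      assume "?d = {}"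
      then have "p ` ?d = {}" by (simp only: image_empty)
      then have "q \<in> convex hull {}" using q by (simp only:)
      then show False by simp
    qed
    then obtain H where H: "H \<in> ?d" "\<And>F. F \<in> ?d \<Longrightarrow> F \<subseteq> H"
      using finite_chain_top[OF d finite_nonempty_faces] by blast
    then have "H \<subset> G" "H \<in> C" using G(2)[of H] chain_member[OF c, of H] by blast+
    moreover have "q \<in> H" using hull_chain_subset[OF d \<open>H \<in> C\<close> H(2)] q by blast
    moreover have "H face_of G" using D(6)[OF GC(1) \<open>H \<in> C\<close>] \<open>H \<subset> G\<close> by (metis inf.absorb2 psubsetE)
    ultimately show ?thesis using face_of_disjoint_rel_interior[of H G] by blast
  qed
  ultimately have *: "z = p G \<or> (\<exists>s q. 0 < s \<and> s < 1 \<and> q \<in> convex hull (p ` ?d) \<and> q \<in> G \<and> q \<notin> rel_interior G \<and>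
      z - p G = s *\<^sub>R (q - p G))" by blast
  then show "z = p G \<or> (\<exists>s q. 0 < s \<and> s < 1 \<and> q \<in> convex hull (p ` (c - {G})) \<and> q \<in> G \<and> q \<notin> rel_interior G \<and>
      z - p G = s *\<^sub>R (q - p G))" by blast
  from * show "z \<in> rel_interior G"
  proof
    assume "\<exists>s q. 0 < s \<and> s < 1 \<and> q \<in> convex hull (p ` ?d) \<and> q \<in> G \<and> q \<notin> rel_interior G \<and>
      z - p G = s *\<^sub>R (q - p G)"
    then obtain s q where sq: "0 < s" "s < 1" "q \<in> G" "z - p G = s *\<^sub>R (q - p G)" by blast
    then have "q - (1 - s) *\<^sub>R (q - p G) \<in> rel_interior G"
      using rel_interior_convex_shrink[OF D(3)[OF GC(1)] GC(2) sq(3), of "1 - s"] by simp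
    moreover have "q - (1 - s) *\<^sub>R (q - p G) = z" using sq(4) by (simp add: algebra_simps)
    ultimately show ?thesis by simp
  qed (use GC in simp)
qed

text \<open>
  Let \<open>G\<close> be the face with \<open>z\<close> in its relative interior. Unless \<open>z\<close> already lies in a smaller
  simplex, \<open>G\<close> is the top of both chains. The ray from \<open>p G\<close> through \<open>z\<close> leaves \<open>G\<close> at a point that lies
  in both simplices over the chains without \<open>G\<close>, and induction applies to this point.
\<close>

lemma hull_chain_Int:
  assumes "c \<in> order_complex (C - {{}})" "c' \<in> order_complex (C - {{}})"
  shows "convex hull (p ` c) \<inter> convex hull (p ` c') \<subseteq> convex hull (p ` (c \<inter> c'))"
  using assms
proof (induction "card c + card c'" arbitrary: c c' rule: less_induct)
  case less
  note D = polyhedral_complexD[OF C]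
  have fin: "finite c" "finite c'"
    using less.prems finite_nonempty_faces unfolding order_complex_def subset_chain_def
    by (auto intro: finite_subset)
  have sub: "d - {F} \<in> order_complex (C - {{}})" if "d \<in> order_complex (C - {{}})" for d F
    using order_complex_subset[OF that] by blast
  have mono: "convex hull (p ` e) \<subseteq> convex hull (p ` (c \<inter> c'))" if "e \<subseteq> c \<inter> c'" for e
    using that by (intro hull_mono image_mono)
  show ?case
  proof
    fix z assume z: "z \<in> convex hull (p ` c) \<inter> convex hull (p ` c')"
    then have "c \<noteq> {}" "c' \<noteq> {}" by auto
    obtain G where G: "G \<in> c" "\<And>F. F \<in> c \<Longrightarrow> F \<subseteq> G"
      using finite_chain_top[OF less.prems(1) finite_nonempty_faces \<open>c \<noteq> {}\<close>] by blast
    obtain G' where G': "G' \<in> c'" "\<And>F. F \<in> c' \<Longrightarrow> F \<subseteq> G'"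
      using finite_chain_top[OF less.prems(2) finite_nonempty_faces \<open>c' \<noteq> {}\<close>] by blast
    have less_card: "card (c - {G}) < card c" "card (c' - {G'}) < card c'"
      using G(1) G'(1) fin by (meson card_Diff1_less)+
    consider "z \<in> convex hull (p ` (c - {G}))" | "z \<in> convex hull (p ` (c' - {G'}))"
      | "z \<notin> convex hull (p ` (c - {G}))" "z \<notin> convex hull (p ` (c' - {G'}))" by blast
    then show "z \<in> convex hull (p ` (c \<inter> c'))"
    proof cases
      case 1
      then have "z \<in> convex hull (p ` ((c - {G}) \<inter> c'))"
        using less.hyps[of "c - {G}" c'] less_card sub less.prems z by auto
      then show ?thesis using mono[of "(c - {G}) \<inter> c'"] by blast
    next
      case 2
      then have "z \<in> convex hull (p ` (c \<inter> (c' - {G'})))"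
        using less.hyps[of c "c' - {G'}"] less_card sub less.prems z by auto
      then show ?thesis using mono[of "c \<inter> (c' - {G'})"] by blast
    next
      case 3
      note dec = hull_chain_decompose[OF less.prems(1) G _ 3(1)]
        and dec' = hull_chain_decompose[OF less.prems(2) G' _ 3(2)]
      have zG: "z \<in> rel_interior G" "z \<in> rel_interior G'" using dec(1) dec'(1) z by blast+
      have GC: "G \<in> C" "p G \<in> rel_interior G" "G' \<in> C"
        using chain_member less.prems G(1) G'(1) by blast+
      have "G = G'"
        using polyhedral_complex_face_subset[OF C] zG GC rel_interior_subset by (metis subset_antisym subsetD)
      note G'_eq = this[symmetric]
      have mem: "G \<in> c \<inter> c'" using G(1) G'(1) G'_eq by simp
      show ?thesis
      proof (cases "z = p G")
        case True
        then show ?thesis using mem by (simp add: hull_inc)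
      next
        case False
        then obtain s q where q: "0 < s" "s < 1" "q \<in> convex hull (p ` (c - {G}))" "q \<in> G" "q \<notin> rel_interior G"
            "z - p G = s *\<^sub>R (q - p G)"
          using dec(2) z by blast
        obtain s' q' where q': "0 < s'" "q' \<in> convex hull (p ` (c' - {G}))" "q' \<in> G" "q' \<notin> rel_interior G"
            "z - p G = s' *\<^sub>R (q' - p G)"
          using dec'(2) z False unfolding G'_eq by blast
        \<comment> \<open>Both \<open>q\<close> and \<open>q'\<close> are the point where the ray from \<open>p G\<close> through \<open>z\<close> leaves \<open>G\<close>.\<close>
        have exit: "a \<le> b" if "0 < a" "0 < b" "a *\<^sub>R (u - p G) = b *\<^sub>R (v - p G)" "u \<notin> rel_interior G" "v \<in> G"
          for a b u v
        proof (rule ccontr)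
          assume "\<not> a \<le> b"
          then have "v - (1 - b / a) *\<^sub>R (v - p G) \<in> rel_interior G"
            using that by (intro rel_interior_convex_shrink[OF D(3)[OF GC(1)] GC(2)]) auto
          moreover have "u = p G + (b / a) *\<^sub>R (v - p G)"
          proof -
            have "(1 / a) *\<^sub>R (a *\<^sub>R (u - p G)) = (1 / a) *\<^sub>R (b *\<^sub>R (v - p G))" using that(3) by simp
            then have "u - p G = (b / a) *\<^sub>R (v - p G)" using that(1) by simp
            then show ?thesis by (simp add: algebra_simps)
          qed
          moreover have "v - (1 - b / a) *\<^sub>R (v - p G) = p G + (b / a) *\<^sub>R (v - p G)"
            by (simp add: scaleR_left_diff_distrib)
          ultimately show False using that(4) by simp
        qed
        have "s = s'"
          using exit[of s s' q q'] exit[of s' s q' q] q q' by simp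
        then have "q = q'" using q(1,6) q'(5) by simp
        then have "q \<in> convex hull (p ` ((c - {G}) \<inter> (c' - {G})))"
          using less.hyps[of "c - {G}" "c' - {G}"] less_card sub less.prems q(3) q'(2) G'_eq by auto
        then have "q \<in> convex hull (p ` (c \<inter> c'))" using mono[of "(c - {G}) \<inter> (c' - {G})"] by blast
        moreover have "p G \<in> convex hull (p ` (c \<inter> c'))" using mem by (simp add: hull_inc)
        moreover have "z = (1 - s) *\<^sub>R p G + s *\<^sub>R q" using q(6) by (simp add: algebra_simps)
        ultimately show ?thesis
          using convexD[OF convex_convex_hull, of "p G" _ q "1 - s" s] q(1,2) by simp
      qed
    qed
  qed
qed

lemma inj_on_face_points: "inj_on p (C - {{}})"
proof (rule inj_onI)
  fix F G assume FG: "F \<in> C - {{}}" "G \<in> C - {{}}" "p F = p G"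
  have "p F \<in> rel_interior F" "p F \<in> rel_interior G" using p FG by force+
  then show "F = G"
    using polyhedral_complex_face_subset[OF C] FG rel_interior_subset
    by (metis DiffD1 subset_antisym subsetD)
qed

text \<open>
  Affine independence is a consequence of the intersection property: a Radon partition of the
  vertices would consist of two disjoint subchains whose hulls intersect.
\<close>

lemma geometric_scheme_chains: "geometric_scheme ((`) p ` order_complex (C - {{}}))"
proof -
  let ?O = "order_complex (C - {{}})"
  have O: "abstract_complex ?O" using abstract_complex_order_complex finite_nonempty_faces by blast
  note sub = order_complex_subset[where S = "C - {{}}"]
  have "abstract_complex ((`) p ` ?O)"
    by (rule abstract_complex_image[OF O])
  moreover have "\<not> affine_dependent (p ` c)" if c: "c \<in> ?O" for c
  proof
    assume "affine_dependent (p ` c)"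
    moreover have "finite (p ` c)" using O c by (simp add: abstract_complex_def)
    ultimately obtain M P where MP: "M \<inter> P = {}" "M \<union> P = p ` c" "convex hull M \<inter> convex hull P \<noteq> {}"
      using Radon_partition by metis
    obtain d where d: "d \<subseteq> c" "M = p ` d" using MP(2) by (metis Un_upper1 subset_image_iff)
    obtain e where e: "e \<subseteq> c" "P = p ` e" using MP(2) by (metis Un_upper2 subset_image_iff)
    have "d \<inter> e = {}" using MP(1) d e by blast
    then show False using hull_chain_Int[OF sub[OF c d(1)] sub[OF c e(1)]] MP(3) d e by simp
  qed
  moreover have "convex hull (p ` c) \<inter> convex hull (p ` d) \<subseteq> convex hull (p ` c \<inter> p ` d)"
    if "c \<in> ?O" "d \<in> ?O" for c d
  proof -
    have "p ` (c \<inter> d) \<subseteq> p ` c \<inter> p ` d" by blast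
    then show ?thesis using hull_chain_Int[OF that] hull_mono by blast
  qed
  ultimately show ?thesis unfolding geometric_scheme_def by blast
qed

text \<open>
  A point of \<open>G\<close> is pushed away from \<open>p G\<close> until it reaches a proper face, which is covered by
  induction on the dimension.
\<close>

lemma Union_hull_chains:
  assumes "\<And>P. P \<in> C \<Longrightarrow> bounded P"
  shows "\<Union>((hull) convex ` (`) p ` order_complex (C - {{}})) = \<Union>C"
proof
  note D = polyhedral_complexD[OF C]
  show "\<Union>((hull) convex ` (`) p ` order_complex (C - {{}})) \<subseteq> \<Union>C"
  proof
    fix z assume "z \<in> \<Union>((hull) convex ` (`) p ` order_complex (C - {{}}))"
    then obtain c where c: "c \<in> order_complex (C - {{}})" "z \<in> convex hull (p ` c)" by blast
    then have "c \<noteq> {}" by auto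
    then obtain G where G: "G \<in> c" "\<And>F. F \<in> c \<Longrightarrow> F \<subseteq> G"
      using finite_chain_top[OF c(1) finite_nonempty_faces] by blast
    then show "z \<in> \<Union>C" using hull_chain_subset[OF c(1) _ G(2)] chain_member[OF c(1) G(1)] c(2) by blast
  qed
  have cover: "\<exists>c\<in>order_complex (C - {{}}). (\<forall>F\<in>c. F \<subseteq> G) \<and> z \<in> convex hull (p ` c)"
    if "G \<in> C" "z \<in> G" for G z
    using that
  proof (induction "nat (aff_dim G)" arbitrary: G z rule: less_induct)
    case less
    have G: "G \<in> C - {{}}" "p G \<in> rel_interior G" using less.prems p by blast+
    show ?case
    proof (cases "z = p G")
      case True
      then show ?thesis using G singleton_in_order_complex[of G "C - {{}}"] by (intro bexI[of _ "{G}"]) auto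
    next
      case False
      define l where "l = z - p G"
      have l: "l \<noteq> 0" "p G + l \<in> affine hull G" using False less.prems by (auto simp: l_def hull_inc)
      obtain d where d: "d > 0" "p G + d *\<^sub>R l \<in> rel_frontier G"
        using ray_to_rel_frontier[OF assms[OF less.prems(1)] G(2) l(2,1)] by blast
      define q where "q = p G + d *\<^sub>R l"
      have "d \<ge> 1"
      proof (rule ccontr)
        assume "\<not> d \<ge> 1"
        then have "z - (1 - d) *\<^sub>R (z - p G) \<in> rel_interior G"
          using d(1) less.prems(2) by (intro rel_interior_convex_shrink[OF D(3)[OF less.prems(1)] G(2)]) auto
        then have "p G + d *\<^sub>R l \<in> rel_interior G" by (simp add: l_def algebra_simps)
        then show False using d(2) by (simp add: rel_frontier_def)
      qed
      obtain H where H: "H face_of G" "H \<noteq> G" "q \<in> H"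
        using d(2) rel_frontier_of_polyhedron_alt[OF D(2)[OF less.prems(1)]] unfolding q_def by blast
      have "aff_dim H < aff_dim G" "aff_dim H \<ge> 0"
        using face_of_aff_dim_lt[OF D(3)[OF less.prems(1)] H(1,2)] H(3) aff_dim_negative_iff[of H] by (auto simp: not_less[symmetric])
      then obtain c where c: "c \<in> order_complex (C - {{}})" "\<forall>F\<in>c. F \<subseteq> H" "q \<in> convex hull (p ` c)"
        using less.hyps[OF _ D(5)[OF less.prems(1) H(1)] H(3)] by auto
      have "\<forall>F\<in>insert G c. F \<subseteq> G" using c(2) face_of_imp_subset[OF H(1)] by blast
      moreover have "insert G c \<in> order_complex (C - {{}})"
        using c(1) G(1) calculation by (simp add: order_complex_def subset_chain_insert)
      moreover have "z \<in> convex hull (p ` insert G c)"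
      proof -
        have "p G \<in> convex hull (p ` insert G c)" "q \<in> convex hull (p ` insert G c)"
          using c(3) hull_mono[of "p ` c" "p ` insert G c" convex] by (auto simp: hull_inc)
        then have "(1 - 1 / d) *\<^sub>R p G + (1 / d) *\<^sub>R q \<in> convex hull (p ` insert G c)"
          using \<open>d \<ge> 1\<close> by (intro convexD[OF convex_convex_hull]) auto
        moreover have "(1 - 1 / d) *\<^sub>R p G + (1 / d) *\<^sub>R q = z"
          using d(1) by (simp add: q_def l_def algebra_simps)
        ultimately show ?thesis by simp
      qed
      ultimately show ?thesis by blast
    qed
  qed
  show "\<Union>C \<subseteq> \<Union>((hull) convex ` (`) p ` order_complex (C - {{}}))"
  proof
    fix z assume "z \<in> \<Union>C"
    then obtain c where "c \<in> order_complex (C - {{}})" "z \<in> convex hull (p ` c)" using cover by blast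
    then show "z \<in> \<Union>((hull) convex ` (`) p ` order_complex (C - {{}}))" by (intro UnionI) auto
  qed
qed

end

lemma derived_subdivision_imp_scheme:
  assumes "polytopal_complex C" "derived_subdivision C D"
  obtains p where "\<And>F. F \<in> C - {{}} \<Longrightarrow> p F \<in> rel_interior F"
    "D = (hull) convex ` (`) p ` order_complex (C - {{}})"
proof -
  obtain p where "\<forall>F\<in>C - {{}}. p F \<in> rel_interior F"
    "D = {convex hull (p ` c) | c. subset.chain (C - {{}}) c}"
    using assms(2) unfolding derived_subdivision_def by blast
  then show thesis
    using that[of p] by (auto simp: order_complex_def image_image setcompr_eq_image)
qed

lemma derived_subdivision_polytopal_complex:
  assumes C: "polytopal_complex C" and D: "derived_subdivision C D"
  shows "polytopal_complex D" "\<Union>D = \<Union>C"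
proof -
  obtain p where p: "\<And>F. F \<in> C - {{}} \<Longrightarrow> p F \<in> rel_interior F"
    "D = (hull) convex ` (`) p ` order_complex (C - {{}})"
    using derived_subdivision_imp_scheme[OF C D] by blast
  note P = polytopal_imp_polyhedral_complex[OF C]
  show "polytopal_complex D"
    using simplicial_imp_polytopal_complex[OF geometric_scheme_simplicial_complex]
      geometric_scheme_chains[OF P p(1)] p(2) by simp
  show "\<Union>D = \<Union>C"
    unfolding p(2)
  proof (rule Union_hull_chains[OF P p(1)])
    show "bounded Q" if "Q \<in> C" for Q
      using C that unfolding polytopal_complex_def by (simp add: polytope_imp_bounded)
  qed
qed

lemma derived_subdivisions_polytopal_complex:
  assumes "polytopal_complex C" "(derived_subdivision ^^ n) C D"
  shows "polytopal_complex D \<and> \<Union>D = \<Union>C"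
  using assms(2)
proof (induction n arbitrary: D)
  case (Suc n)
  then obtain B where "(derived_subdivision ^^ n) C B" "derived_subdivision B D" by auto
  then show ?case using Suc.IH derived_subdivision_polytopal_complex by metis
qed (use assms(1) in simp)

lemma derived_subdivision_non_evasive:
  assumes C: "polytopal_complex C" and D: "derived_subdivision C D"
    and "abstract_non_evasive (order_complex (C - {{}}))"
  shows "non_evasive D \<and> collapsible D"
proof -
  obtain p where p: "\<And>F. F \<in> C - {{}} \<Longrightarrow> p F \<in> rel_interior F"
    "D = (hull) convex ` (`) p ` order_complex (C - {{}})"
    using derived_subdivision_imp_scheme[OF C D] by blast
  note P = polytopal_imp_polyhedral_complex[OF C]
  have "inj_on p (C - {{}})" by (rule inj_on_face_points[OF P]) (rule p(1))
  then have "abstract_non_evasive ((`) p ` order_complex (C - {{}}))"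
    using abstract_non_evasive_image[OF assms(3)] by (simp only: Union_order_complex)
  then show ?thesis
    using geometric_scheme_non_evasive[OF geometric_scheme_chains[OF P p(1)]] p(2) by simp
qed

section \<open>The Euler characteristic of a non-evasive complex\<close>

text \<open>
  This is \<open>1 - \<chi> X\<close>, where \<open>\<chi>\<close> is the Euler characteristic: the empty face contributes \<open>1\<close>.
\<close>

definition alternating_sum :: "'v set set \<Rightarrow> int" where
  "alternating_sum X = (\<Sum>s\<in>X. (-1) ^ card s)"

lemma alternating_sum_vertex_split:
  assumes X: "abstract_complex X"
  shows "alternating_sum X = alternating_sum (vertex_deletion v X) - alternating_sum (vertex_link v X)"
proof -
  let ?D = "vertex_deletion v X" and ?L = "vertex_link v X"
  have fin: "finite ?D" "finite ?L" "\<And>s. s \<in> ?L \<Longrightarrow> finite s \<and> v \<notin> s"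
    using X by (auto simp: abstract_complex_def vertex_deletion_def vertex_link_def)
  have inj: "inj_on (insert v) ?L" using fin(3) by (meson inj_onI insert_ident)
  have "alternating_sum X = alternating_sum ?D + (\<Sum>s\<in>insert v ` ?L. (-1) ^ card s)"
    unfolding alternating_sum_def
    by (subst abstract_complex_star_decomposition[OF X, of v], rule sum.union_disjoint) (use fin in \<open>auto simp: vertex_deletion_def\<close>)
  also have "(\<Sum>s\<in>insert v ` ?L. (-1) ^ card s) = (\<Sum>s\<in>?L. - ((-1) ^ card s :: int))"
    unfolding sum.reindex[OF inj] by (rule sum.cong) (use fin(3) in auto)
  finally show ?thesis by (simp add: alternating_sum_def sum_negf)
qed

lemma abstract_non_evasive_alternating_sum:
  assumes "abstract_non_evasive X" "abstract_complex X"
  shows "alternating_sum X = 0"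
  using assms
proof (induction rule: abstract_non_evasive.induct)
  case (step v X)
  then show ?case
    using alternating_sum_vertex_split[OF step.prems, of v] abstract_complex_vertex_link[OF step.prems, of v]
      abstract_complex_vertex_deletion[OF step.prems, of v] by simp
qed (simp add: alternating_sum_def)

text \<open>A nonempty chain is its top element together with a chain of smaller elements.\<close>

lemma alternating_sum_order_complex:
  assumes "finite S"
  shows "alternating_sum (order_complex S) = 1 - (\<Sum>a\<in>S. alternating_sum (order_complex {b \<in> S. b \<subset> a}))"
proof -
  let ?below = "\<lambda>a. order_complex {b \<in> S. b \<subset> a}"
  have fin: "finite c" if "c \<in> order_complex S" for c
    using abstract_complex_order_complex[OF assms] that by (simp add: abstract_complex_def)
  have below: "c \<in> order_complex S \<and> a \<notin> c \<and> (\<forall>b\<in>c. b \<subset> a)" if "c \<in> ?below a" for c a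
    using that by (auto simp: order_complex_def subset_chain_def)
  have "order_complex S = insert {} (\<Union>a\<in>S. insert a ` ?below a)"
  proof (intro equalityI subsetI)
    fix c assume c: "c \<in> order_complex S"
    show "c \<in> insert {} (\<Union>a\<in>S. insert a ` ?below a)"
    proof (cases "c = {}")
      case False
      then obtain a where a: "a \<in> c" "\<And>b. b \<in> c \<Longrightarrow> b \<subseteq> a" using finite_chain_top[OF c assms] by blast
      have "c \<subseteq> S" "\<forall>b\<in>c. \<forall>d\<in>c. b \<subseteq> d \<or> d \<subseteq> b" using c by (auto simp: order_complex_def subset_chain_def)
      moreover then have "b \<in> S \<and> b \<subset> a" if "b \<in> c - {a}" for b using a(2)[of b] that by blast
      ultimately have "c - {a} \<in> ?below a"
        unfolding order_complex_def subset_chain_def by simp blast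
      moreover have "c = insert a (c - {a})" using a(1) by blast
      moreover have "a \<in> S" using a(1) \<open>c \<subseteq> S\<close> by blast
      ultimately show ?thesis by blast
    qed simp
  next
    fix c assume "c \<in> insert {} (\<Union>a\<in>S. insert a ` ?below a)"
    then show "c \<in> order_complex S"
    proof
      assume "c \<in> (\<Union>a\<in>S. insert a ` ?below a)"
      then obtain a d where "a \<in> S" "d \<in> ?below a" "c = insert a d" by blast
      then show ?thesis
        using below[of d a] unfolding order_complex_def by (simp add: subset_chain_insert) blast
    qed (simp add: order_complex_def subset_chain_def)
  qed
  then have "alternating_sum (order_complex S) = (\<Sum>c\<in>insert {} (\<Union>a\<in>S. insert a ` ?below a). (-1) ^ card c)"
    by (simp add: alternating_sum_def)
  also have "\<dots> = 1 + (\<Sum>c\<in>(\<Union>a\<in>S. insert a ` ?below a). (-1) ^ card c)"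
    using assms by (subst sum.insert) (auto simp: abstract_complex_order_complex[unfolded abstract_complex_def])
  also have "(\<Sum>c\<in>(\<Union>a\<in>S. insert a ` ?below a). (-1) ^ card c :: int) =
      (\<Sum>a\<in>S. \<Sum>c\<in>insert a ` ?below a. (-1) ^ card c)"
  proof (rule sum.UNION_disjoint)
    show "\<forall>a\<in>S. finite (insert a ` ?below a)"
      using assms by (auto simp: abstract_complex_order_complex[unfolded abstract_complex_def])
    show "\<forall>a\<in>S. \<forall>b\<in>S. a \<noteq> b \<longrightarrow> insert a ` ?below a \<inter> insert b ` ?below b = {}"
    proof (intro ballI impI, rule ccontr)
      fix a b assume "a \<noteq> b" "insert a ` ?below a \<inter> insert b ` ?below b \<noteq> {}"
      then obtain c d where cd: "c \<in> ?below a" "d \<in> ?below b" "insert a c = insert b d" by auto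
      then have "a \<in> d" "b \<in> c" using \<open>a \<noteq> b\<close> by blast+
      then show False using below[OF cd(1)] below[OF cd(2)] by blast
    qed
  qed (rule assms)
  also have "\<dots> = (\<Sum>a\<in>S. - alternating_sum (?below a))"
  proof (rule sum.cong[OF refl])
    fix a
    have inj: "inj_on (insert a) (?below a)" using below by (meson inj_onI insert_ident)
    have "card (insert a c) = Suc (card c)" if "c \<in> ?below a" for c
      using below[OF that] fin by simp
    then show "(\<Sum>c\<in>insert a ` ?below a. (-1) ^ card c) = - alternating_sum (?below a)"
      unfolding sum.reindex[OF inj] alternating_sum_def sum_negf[symmetric] by (intro sum.cong) auto
  qed
  finally show ?thesis by (simp add: sum_negf)
qed

lemma alternating_sum_Pow:
  assumes "finite s" "s \<noteq> {}"
  shows "alternating_sum (Pow s) = 0"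
proof -
  obtain v where v: "v \<in> s" using assms(2) by blast
  have "vertex_deletion v (Pow s) = Pow (s - {v})" "vertex_link v (Pow s) = Pow (s - {v})"
    using v by (auto simp: vertex_deletion_def vertex_link_def)
  moreover have "abstract_complex (Pow s)"
    using assms(1) by (auto simp: abstract_complex_def intro: finite_subset)
  ultimately show ?thesis using alternating_sum_vertex_split[of "Pow s" v] by simp
qed

lemma alternating_sum_order_complex_boundary:
  assumes "finite s" "s \<noteq> {}"
  shows "alternating_sum (order_complex {t. t \<noteq> {} \<and> t \<subset> s}) = - ((-1) ^ card s)"
  using assms
proof (induction "card s" arbitrary: s rule: less_induct)
  case less
  let ?S = "{t. t \<noteq> {} \<and> t \<subset> s}"
  have fin: "finite ?S" by (rule finite_subset[of _ "Pow s"]) (use less.prems in auto)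
  have "alternating_sum (order_complex ?S) = 1 - (\<Sum>a\<in>?S. alternating_sum (order_complex {b \<in> ?S. b \<subset> a}))"
    by (rule alternating_sum_order_complex[OF fin])
  also have "(\<Sum>a\<in>?S. alternating_sum (order_complex {b \<in> ?S. b \<subset> a})) = (\<Sum>a\<in>?S. - ((-1) ^ card a))"
  proof (rule sum.cong[OF refl])
    fix a assume a: "a \<in> ?S"
    then have "{b \<in> ?S. b \<subset> a} = {t. t \<noteq> {} \<and> t \<subset> a}" by blast
    moreover have "card a < card s" "finite a" "a \<noteq> {}"
      using a less.prems by (auto intro: psubset_card_mono finite_subset)
    ultimately show "alternating_sum (order_complex {b \<in> ?S. b \<subset> a}) = - ((-1) ^ card a)"
      using less.hyps by simp
  qed
  also have "\<dots> = - (\<Sum>a\<in>?S. (-1) ^ card a)" by (rule sum_negf)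
  finally have "alternating_sum (order_complex ?S) = 1 + (\<Sum>a\<in>?S. (-1) ^ card a)" by simp
  moreover have "Pow s = insert {} (insert s ?S)" using less.prems by auto
  then have "alternating_sum (Pow s) = 1 + ((-1) ^ card s + (\<Sum>a\<in>?S. (-1) ^ card a))"
    using fin less.prems(2) by (simp add: alternating_sum_def)
  ultimately show ?case using alternating_sum_Pow[OF less.prems] by simp
qed

text \<open>
  The chains with top \<open>s\<close> contribute \<open>(-1)\<close> to the power \<open>card s\<close> in total, since the proper
  faces of \<open>s\<close> form a sphere.
\<close>

lemma alternating_sum_subdivision:
  assumes X: "abstract_complex X" "{} \<in> X"
  shows "alternating_sum (order_complex (X - {{}})) = alternating_sum X"
proof -
  let ?S = "X - {{}}"
  have fin: "finite ?S" using X(1) by (simp add: abstract_complex_def)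
  have "(\<Sum>a\<in>?S. alternating_sum (order_complex {b \<in> ?S. b \<subset> a})) = (\<Sum>a\<in>?S. - ((-1) ^ card a))"
  proof (rule sum.cong[OF refl])
    fix a assume a: "a \<in> ?S"
    then have "Pow a \<subseteq> X" "finite a" using X(1) by (auto simp: abstract_complex_def)
    then have "{b \<in> ?S. b \<subset> a} = {t. t \<noteq> {} \<and> t \<subset> a}" by blast
    then show "alternating_sum (order_complex {b \<in> ?S. b \<subset> a}) = - ((-1) ^ card a)"
      using alternating_sum_order_complex_boundary[OF \<open>finite a\<close>] a by simp
  qed
  also have "\<dots> = - (\<Sum>a\<in>?S. (-1) ^ card a)" by (rule sum_negf)
  finally have "alternating_sum (order_complex ?S) = 1 + (\<Sum>a\<in>?S. (-1) ^ card a)"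
    using alternating_sum_order_complex[OF fin] by simp
  moreover have "X = insert {} ?S" using X(2) by blast
  then have "alternating_sum X = 1 + (\<Sum>a\<in>?S. (-1) ^ card a)"
    unfolding alternating_sum_def using fin by (metis (no_types, lifting) DiffD2 card.empty insertI1 power_0 sum.insert)
  ultimately show ?thesis by simp
qed

section \<open>Connectivity\<close>

text \<open>
  Connectivity of the graph on \<open>W\<close> is expressed by cuts instead of paths, because cuts are easily
  transferred between a complex, its subdivision and its links.
\<close>

definition edge_connected_on :: "'v set set \<Rightarrow> 'v set \<Rightarrow> bool" where
  "edge_connected_on X W \<longleftrightarrow> (\<forall>A. A \<noteq> {} \<and> A \<subset> W \<longrightarrow> (\<exists>a\<in>A. \<exists>b\<in>W - A. {a, b} \<in> X))"

lemma edge_connected_onD: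
  "edge_connected_on X W \<Longrightarrow> A \<noteq> {} \<Longrightarrow> A \<subset> W \<Longrightarrow> \<exists>a\<in>A. \<exists>b\<in>W - A. {a, b} \<in> X"
  unfolding edge_connected_on_def by simp

lemma abstract_complex_subset: "abstract_complex X \<Longrightarrow> s \<in> X \<Longrightarrow> t \<subseteq> s \<Longrightarrow> t \<in> X"
  unfolding abstract_complex_def by blast

lemma abstract_complex_vertex: "abstract_complex X \<Longrightarrow> w \<in> \<Union>X \<Longrightarrow> {w} \<in> X"
  using abstract_complex_subset by (metis Union_iff empty_subsetI insert_subset)

text \<open>
  The deletion is connected by induction, and \<open>v\<close> is joined to it by an edge to a vertex of its
  link.
\<close>

lemma abstract_non_evasive_edge_connected:
  assumes "abstract_non_evasive X" "abstract_complex X"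
  shows "edge_connected_on X (\<Union>X)"
  using assms
proof (induction rule: abstract_non_evasive.induct)
  case (point v)
  then show ?case by (auto simp: edge_connected_on_def)
next
  case (step v X)
  let ?D = "\<Union>(vertex_deletion v X)"
  have D: "?D = \<Union>X - {v}"
  proof (intro equalityI subsetI)
    fix w assume "w \<in> \<Union>X - {v}"
    then have "{w} \<in> vertex_deletion v X"
      using abstract_complex_vertex[OF step.prems, of w] by (auto simp: vertex_deletion_def)
    then show "w \<in> ?D" by blast
  qed (auto simp: vertex_deletion_def)
  have conn: "edge_connected_on (vertex_deletion v X) ?D"
    using step.IH(2) abstract_complex_vertex_deletion[OF step.prems] by blast
  obtain w where "{w} \<in> vertex_link v X" using abstract_non_evasive_has_vertex[OF step.hyps(2)] by blast
  then have w: "w \<noteq> v" "{v, w} \<in> X" by (auto simp: vertex_link_def)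
  show ?case
    unfolding edge_connected_on_def
  proof (intro allI impI)
    fix A assume A: "A \<noteq> {} \<and> A \<subset> \<Union>X"
    show "\<exists>a\<in>A. \<exists>b\<in>\<Union>X - A. {a, b} \<in> X"
    proof (cases "A \<inter> ?D = {} \<or> ?D \<subseteq> A")
      case True
      have vw: "v \<in> \<Union>X" "w \<in> \<Union>X" using w(2) by blast+
      have "A \<subseteq> {v} \<or> \<Union>X - {v} \<subseteq> A" using True A unfolding D by blast
      then consider "A = {v}" | "w \<in> A" "v \<notin> A" using A w(1) vw by auto
      then show ?thesis
      proof cases
        case 1
        then show ?thesis using w vw(2) by blast
      next
        case 2
        then show ?thesis using w(2) vw(1) by (metis DiffI insert_commute)
      qed
    next
      case False
      then have "A \<inter> ?D \<noteq> {}" "A \<inter> ?D \<subset> ?D" by blast+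
      note edge_connected_onD[OF conn this]
      then obtain a b where "a \<in> A \<inter> ?D" "b \<in> ?D - (A \<inter> ?D)" "{a, b} \<in> vertex_deletion v X"
        by (elim bexE)
      then show ?thesis using D unfolding vertex_deletion_def by blast
    qed
  qed
qed

text \<open>
  If no edge crosses a cut of the vertices, then no face does, and comparable faces lie on the same
  side.
\<close>

lemma edge_connected_subdivision:
  assumes X: "abstract_complex X"
    and conn: "edge_connected_on (order_complex (X - {{}})) (X - {{}})"
  shows "edge_connected_on X (\<Union>X)"
  unfolding edge_connected_on_def
proof (intro allI impI)
  fix A assume A: "A \<noteq> {} \<and> A \<subset> \<Union>X"
  let ?F = "{s \<in> X. s \<inter> A \<noteq> {}}"
  obtain a b where ab: "a \<in> A" "b \<in> \<Union>X - A" using A by blast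
  then have "{a} \<in> X" "{b} \<in> X" using abstract_complex_vertex[OF X] A by auto
  then have "{a} \<in> ?F" "{b} \<in> X - {{}}" "{b} \<notin> ?F" using ab by simp_all
  moreover have "?F \<subseteq> X - {{}}" by auto
  ultimately have "?F \<noteq> {}" "?F \<subset> X - {{}}" by (metis empty_iff, metis psubsetI)
  note edge_connected_onD[OF conn this]
  then obtain s t where st: "s \<in> ?F" "t \<in> X - {{}} - ?F" "{s, t} \<in> order_complex (X - {{}})"
    by (elim bexE)
  then have "s \<subseteq> t \<or> t \<subseteq> s" by (auto simp: order_complex_def subset_chain_def)
  then have "t \<subseteq> s" using st(1,2) by blast
  have "t \<noteq> {}" "t \<inter> A = {}" "s \<in> X" "t \<in> X" using st(1,2) by simp_all
  obtain a' where a': "a' \<in> s" "a' \<in> A" using st(1) by blast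
  obtain b' where b': "b' \<in> t" using \<open>t \<noteq> {}\<close> by blast
  then have "{a', b'} \<subseteq> s" "b' \<in> \<Union>X - A"
    using a' \<open>t \<subseteq> s\<close> \<open>t \<inter> A = {}\<close> \<open>t \<in> X\<close> by blast+
  then show "\<exists>a\<in>A. \<exists>b\<in>\<Union>X - A. {a, b} \<in> X"
    using abstract_complex_subset[OF X \<open>s \<in> X\<close>] a'(2) by blast
qed

section \<open>Non-evasiveness from the Euler characteristic\<close>

definition induced_complex :: "'v set set \<Rightarrow> 'v set \<Rightarrow> 'v set set" where
  "induced_complex X W = {s \<in> X. s \<subseteq> W}"

lemma abstract_complex_induced: "abstract_complex X \<Longrightarrow> abstract_complex (induced_complex X W)"
  unfolding abstract_complex_def induced_complex_def by auto

lemma vertex_deletion_induced: "vertex_deletion v (induced_complex X W) = induced_complex X (W - {v})"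
  unfolding vertex_deletion_def induced_complex_def by blast

lemma induced_complex_singleton:
  assumes "abstract_complex X" "w \<in> \<Union>X"
  shows "induced_complex X {w} = {{}, {w}}"
  using abstract_complex_vertex[OF assms] abstract_complex_subset[OF assms(1), of "{w}" "{}"]
  by (auto simp: induced_complex_def subset_singleton_iff)

text \<open>
  For a nonempty forest, \<open>alternating_sum\<close> is one minus the number of components. So the three
  cases are the empty graph, trees, and forests with several components.
\<close>

definition forest_like :: "'v set set \<Rightarrow> bool" where
  "forest_like L \<longleftrightarrow> L = {{}} \<or> abstract_non_evasive L \<or> alternating_sum L < 0"

text \<open>
  Leaves and isolated vertices are peeled off. A leaf changes neither the sum nor non-evasiveness;
  an isolated vertex added to a nonempty forest lowers the sum by one.
\<close>

lemma forest_like_from_leaves: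
  assumes L: "abstract_complex L" "{} \<in> L"
    and leaf: "\<And>U. U \<subseteq> \<Union>L \<Longrightarrow> U \<noteq> {} \<Longrightarrow>
      \<exists>w\<in>U. vertex_link w (induced_complex L U) = {{}} \<or> (\<exists>p. vertex_link w (induced_complex L U) = {{}, {p}})"
  shows "forest_like L"
proof -
  have "finite (\<Union>L)" using L(1) by (simp add: abstract_complex_def)
  have claim: "abstract_non_evasive (induced_complex L U) \<or> alternating_sum (induced_complex L U) < 0"
    if "U \<subseteq> \<Union>L" "U \<noteq> {}" for U
    using that
  proof (induction "card U" arbitrary: U rule: less_induct)
    case less
    let ?I = "induced_complex L U"
    obtain w where w: "w \<in> U" "vertex_link w ?I = {{}} \<or> (\<exists>p. vertex_link w ?I = {{}, {p}})"
      using leaf[OF less.prems] by blast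
    have card: "card (U - {w}) < card U"
      using w(1) less.prems(1) \<open>finite (\<Union>L)\<close> by (meson card_Diff1_less finite_subset)
    have ac: "abstract_complex ?I" by (rule abstract_complex_induced[OF L(1)])
    have "w \<in> \<Union>L" using w(1) less.prems(1) by blast
    then have wL: "{w} \<in> ?I"
      using abstract_complex_vertex[OF L(1)] w(1) by (simp add: induced_complex_def)
    note split = alternating_sum_vertex_split[OF ac, of w, unfolded vertex_deletion_induced]
    show ?case
    proof (cases "U = {w}")
      case True
      then show ?thesis
        using induced_complex_singleton[OF L(1)] less.prems(1) abstract_non_evasive.point by auto
    next
      case False
      then have IH: "abstract_non_evasive (induced_complex L (U - {w})) \<or> alternating_sum (induced_complex L (U - {w})) < 0"
        using less.hyps[OF card] less.prems(1) w(1) by blast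
      from w(2) show ?thesis
      proof
        assume "vertex_link w ?I = {{}}"
        then have "alternating_sum ?I = alternating_sum (induced_complex L (U - {w})) - 1"
          using split by (simp add: alternating_sum_def)
        then show ?thesis
          using IH abstract_non_evasive_alternating_sum abstract_complex_induced[OF L(1), of "U - {w}"] by force
      next
        assume "\<exists>p. vertex_link w ?I = {{}, {p}}"
        then obtain p where p: "vertex_link w ?I = {{}, {p}}" by blast
        then have "alternating_sum ?I = alternating_sum (induced_complex L (U - {w}))"
          using split by (simp add: alternating_sum_def)
        moreover have "abstract_non_evasive ?I" if "abstract_non_evasive (induced_complex L (U - {w}))"
          by (rule abstract_non_evasive.step[OF wL, unfolded vertex_deletion_induced p,
                OF abstract_non_evasive.point that])
        ultimately show ?thesis using IH by auto
      qed
    qed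
  qed
  show ?thesis
  proof (cases "\<Union>L = {}")
    case True
    then have "L = {{}}" using L(2) by blast
    then show ?thesis by (simp add: forest_like_def)
  next
    case False
    have "induced_complex L (\<Union>L) = L" by (auto simp: induced_complex_def)
    then show ?thesis using claim[OF order_refl False] by (simp add: forest_like_def)
  qed
qed

text \<open>
  At a cut vertex, a cut of the remaining vertices gives the two parts, and both keep \<open>w\<close>.
\<close>

lemma edge_connected_split:
  assumes X: "abstract_complex X" and conn: "edge_connected_on X W" and w: "w \<in> W"
    and nconn: "\<not> edge_connected_on X (W - {w})"
  obtains W1 W2 where "W1 \<union> W2 = W" "W1 \<inter> W2 = {w}" "W1 \<noteq> {w}" "W2 \<noteq> {w}"
    "edge_connected_on X W1" "edge_connected_on X W2"
    "induced_complex X W = induced_complex X W1 \<union> induced_complex X W2"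
proof -
  obtain A where "A \<noteq> {} \<and> A \<subset> W - {w}" "\<not> (\<exists>a\<in>A. \<exists>b\<in>W - {w} - A. {a, b} \<in> X)"
    using nconn unfolding edge_connected_on_def by meson
  then have A: "A \<noteq> {}" "A \<subset> W - {w}" "\<And>a b. a \<in> A \<Longrightarrow> b \<in> W - {w} - A \<Longrightarrow> {a, b} \<notin> X"
    by meson+
  have conn_part: "edge_connected_on X (insert w P)"
    if P: "P \<subseteq> W - {w}" "\<And>a b. a \<in> P \<Longrightarrow> b \<in> W - {w} - P \<Longrightarrow> {a, b} \<notin> X" for P
    unfolding edge_connected_on_def
  proof (intro allI impI)
    fix B assume B: "B \<noteq> {} \<and> B \<subset> insert w P"
    \<comment> \<open>By the choice of \<open>P\<close>, an edge from a part of \<open>P\<close> to the rest of \<open>W\<close> cannot leave \<open>insert w P\<close>.\<close>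
    have cross: "\<exists>a\<in>B'. \<exists>b\<in>insert w P - B'. {a, b} \<in> X" if B': "B' \<noteq> {}" "B' \<subseteq> P" for B'
    proof -
      have "B' \<subset> W" using B' P(1) w by blast
      then obtain a b where ab: "a \<in> B'" "b \<in> W - B'" "{a, b} \<in> X"
        using edge_connected_onD[OF conn B'(1)] by blast
      have "b \<in> insert w P" using P(2)[of a b] ab B'(2) by blast
      then show ?thesis using ab by blast
    qed
    show "\<exists>a\<in>B. \<exists>b\<in>insert w P - B. {a, b} \<in> X"
    proof (cases "w \<in> B")
      case False
      then have "B \<noteq> {}" "B \<subseteq> P" using B by blast+
      then show ?thesis by (rule cross)
    next
      case True
      let ?B' = "insert w P - B"
      have "?B' \<noteq> {}" "?B' \<subseteq> P" using B True by blast+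
      then obtain a b where "a \<in> ?B'" "b \<in> insert w P - ?B'" "{a, b} \<in> X" using cross by meson
      moreover then have "b \<in> B" "{b, a} \<in> X" using B by (auto simp: insert_commute)
      ultimately show ?thesis by blast
    qed
  qed
  let ?B = "W - {w} - A"
  show thesis
  proof (rule that[of "insert w A" "insert w ?B"])
    show "edge_connected_on X (insert w A)" using conn_part[of A] A(2,3) by blast
    show "edge_connected_on X (insert w ?B)"
    proof (rule conn_part)
      fix a b assume "a \<in> ?B" "b \<in> W - {w} - ?B"
      then show "{a, b} \<notin> X" using A(3)[of b a] by (auto simp: insert_commute)
    qed blast
    show "induced_complex X W = induced_complex X (insert w A) \<union> induced_complex X (insert w ?B)"
    proof (intro equalityI subsetI)
      fix s assume s: "s \<in> induced_complex X W"
      have "\<not> (a \<in> s \<and> a \<in> A \<and> b \<in> s \<and> b \<in> ?B)" for a b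
      proof
        assume *: "a \<in> s \<and> a \<in> A \<and> b \<in> s \<and> b \<in> ?B"
        then have "{a, b} \<in> X"
          using s abstract_complex_subset[OF X, of s "{a, b}"] by (simp add: induced_complex_def)
        then show False using A(3) * by blast
      qed
      then have "s \<subseteq> insert w A \<or> s \<subseteq> insert w ?B" using s unfolding induced_complex_def by blast
      then show "s \<in> induced_complex X (insert w A) \<union> induced_complex X (insert w ?B)"
        using s by (auto simp: induced_complex_def)
    qed (use A(2) w in \<open>auto simp: induced_complex_def\<close>)
  qed (use A(1,2) w in blast)+
qed

text \<open>
  Both sides of a cut of \<open>W - {v}\<close> without crossing edges would be joined to \<open>v\<close> and hence meet the
  link of \<open>v\<close>, which is connected.
\<close>

lemma edge_connected_delete_vertex:
  assumes X: "abstract_complex X" and conn: "edge_connected_on X W" and v: "v \<in> W"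
    and link: "abstract_non_evasive (vertex_link v (induced_complex X W))"
  shows "edge_connected_on X (W - {v})"
  unfolding edge_connected_on_def
proof (intro allI impI, rule ccontr)
  fix A assume A: "A \<noteq> {} \<and> A \<subset> W - {v}" and no: "\<not> (\<exists>a\<in>A. \<exists>b\<in>W - {v} - A. {a, b} \<in> X)"
  let ?B = "W - {v} - A" and ?L = "vertex_link v (induced_complex X W)"
  have L: "abstract_complex ?L"
    by (intro abstract_complex_vertex_link abstract_complex_induced X)
  have inL: "a \<in> \<Union>?L" if "{a, v} \<in> X" "a \<in> W" "a \<noteq> v" for a
  proof -
    have "{a} \<in> X" using abstract_complex_subset[OF X that(1)] by blast
    then have "{a} \<in> ?L" using that v by (simp add: vertex_link_def induced_complex_def insert_commute)
    then show ?thesis by blast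
  qed
  have "A \<subset> W" "?B \<subset> W" "?B \<noteq> {}" using A v by blast+
  obtain a b where "a \<in> A" "b \<in> W - A" "{a, b} \<in> X"
    using edge_connected_onD[OF conn _ \<open>A \<subset> W\<close>] A by blast
  moreover then have "b = v" using no by blast
  ultimately have a: "a \<in> A \<inter> \<Union>?L" using inL[of a] A by blast
  obtain c d where "c \<in> ?B" "d \<in> W - ?B" "{c, d} \<in> X"
    using edge_connected_onD[OF conn \<open>?B \<noteq> {}\<close> \<open>?B \<subset> W\<close>] by blast
  moreover then have "d = v" using no by (metis DiffD1 DiffD2 DiffI insert_commute singletonD)
  ultimately have c: "c \<in> \<Union>?L - A" using inL[of c] by blast
  have "A \<inter> \<Union>?L \<noteq> {}" "A \<inter> \<Union>?L \<subset> \<Union>?L" using a c by blast+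
  note edge_connected_onD[OF abstract_non_evasive_edge_connected[OF link L] this]
  then obtain e f where "e \<in> A \<inter> \<Union>?L" "f \<in> \<Union>?L - (A \<inter> \<Union>?L)" "{e, f} \<in> ?L"
    by (elim bexE)
  moreover have "\<Union>?L \<subseteq> W - {v}" "?L \<subseteq> X" by (auto simp: vertex_link_def induced_complex_def)
  ultimately show False using no by blast
qed

text \<open>
  This is what the following arguments use of the plane. Two vertices are provided in order that a
  prescribed vertex can be avoided.
\<close>

locale planar_like_complex =
  fixes X :: "'v set set"
  assumes X: "abstract_complex X"
    and forest_links: "\<And>W. W \<subseteq> \<Union>X \<Longrightarrow> card W \<ge> 2 \<Longrightarrow> \<exists>v\<in>W. \<exists>v'\<in>W. v \<noteq> v' \<and>
      forest_like (vertex_link v (induced_complex X W)) \<and>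
      forest_like (vertex_link v' (induced_complex X W))"
begin

lemma finite_vertices: "W \<subseteq> \<Union>X \<Longrightarrow> finite W"
  using X by (meson abstract_complex_def finite_Union finite_subset)

lemma induced_sum_split:
  "alternating_sum (induced_complex X W) =
     alternating_sum (induced_complex X (W - {v})) - alternating_sum (vertex_link v (induced_complex X W))"
  using alternating_sum_vertex_split[OF abstract_complex_induced[OF X], of W v]
  by (simp add: vertex_deletion_induced)

lemma induced_sum_wedge:
  assumes "induced_complex X W = induced_complex X W1 \<union> induced_complex X W2" "W1 \<inter> W2 = {w}" "w \<in> \<Union>X"
  shows "alternating_sum (induced_complex X W) =
    alternating_sum (induced_complex X W1) + alternating_sum (induced_complex X W2)"
proof -
  have "induced_complex X W1 \<inter> induced_complex X W2 = induced_complex X (W1 \<inter> W2)"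
    by (auto simp: induced_complex_def)
  then have "induced_complex X W1 \<inter> induced_complex X W2 = {{}, {w}}"
    using induced_complex_singleton[OF X assms(3)] assms(2) by simp
  moreover have "finite (induced_complex X U)" for U
    using abstract_complex_induced[OF X] by (simp add: abstract_complex_def)
  ultimately show ?thesis
    using sum.union_inter[of "induced_complex X W1" "induced_complex X W2" "\<lambda>s. (-1 :: int) ^ card s"]
    by (simp add: alternating_sum_def assms(1))
qed

lemma link_alternatives:
  assumes "edge_connected_on X W" "W \<subseteq> \<Union>X" "card W \<ge> 2" "v \<in> W"
    "forest_like (vertex_link v (induced_complex X W))"
  shows "abstract_non_evasive (vertex_link v (induced_complex X W)) \<or>
    alternating_sum (vertex_link v (induced_complex X W)) < 0"
proof -
  have "W \<noteq> {v}" using assms(3) by auto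
  then have "{v} \<subset> W" using assms(4) by blast
  then obtain b where b: "b \<in> W - {v}" "{v, b} \<in> X" using edge_connected_onD[OF assms(1)] by blast
  moreover have "{b} \<in> X" using abstract_complex_subset[OF X b(2)] by blast
  ultimately have "{b} \<in> vertex_link v (induced_complex X W)"
    using assms(4) by (auto simp: vertex_link_def induced_complex_def)
  then show ?thesis using assms(5) unfolding forest_like_def by auto
qed

lemma link_sum_le_0:
  assumes "abstract_non_evasive (vertex_link v (induced_complex X W)) \<or>
    alternating_sum (vertex_link v (induced_complex X W)) < 0"
  shows "alternating_sum (vertex_link v (induced_complex X W)) \<le> 0"
  using assms abstract_non_evasive_alternating_sum
    abstract_complex_vertex_link[OF abstract_complex_induced[OF X], of v W] by fastforce

text \<open>
  In terms of the Euler characteristic, this bounds it by 1. A vertex with a forest as its link is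
  deleted if the rest is connected; otherwise it is a cut vertex, and the complex is a wedge of two
  smaller ones.
\<close>

lemma connected_sum_nonneg:
  assumes "edge_connected_on X W" "W \<subseteq> \<Union>X" "W \<noteq> {}"
  shows "alternating_sum (induced_complex X W) \<ge> 0"
  using assms
proof (induction "card W" arbitrary: W rule: less_induct)
  case less
  have fin: "finite W" using finite_vertices less.prems(2) by blast
  show ?case
  proof (cases "card W \<ge> 2")
    case False
    moreover have "card W > 0" using less.prems(3) fin by (simp add: card_gt_0_iff)
    ultimately have "card W = 1" by linarith
    then obtain w where "W = {w}" using card_1_singletonE by blast
    then show ?thesis using induced_complex_singleton[OF X] less.prems(2) by (simp add: alternating_sum_def)
  next
    case True
    then obtain v where v: "v \<in> W" "forest_like (vertex_link v (induced_complex X W))"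
      using forest_links[OF less.prems(2)] by blast
    show ?thesis
    proof (cases "edge_connected_on X (W - {v})")
      case True
      have "W \<noteq> {v}" using \<open>card W \<ge> 2\<close> by auto
      then have "W - {v} \<noteq> {}" using v(1) by blast
      moreover have "card (W - {v}) < card W" using fin v(1) by (rule card_Diff1_less)
      ultimately have "alternating_sum (induced_complex X (W - {v})) \<ge> 0"
        using less.hyps[of "W - {v}"] True less.prems(2) by blast
      then show ?thesis
        using induced_sum_split[of W v]
          link_sum_le_0[OF link_alternatives[OF less.prems(1,2) \<open>card W \<ge> 2\<close> v]] by simp
    next
      case False
      obtain W1 W2 where S: "W1 \<union> W2 = W" "W1 \<inter> W2 = {v}" "W1 \<noteq> {v}" "W2 \<noteq> {v}"
        "edge_connected_on X W1" "edge_connected_on X W2"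
        "induced_complex X W = induced_complex X W1 \<union> induced_complex X W2"
        using edge_connected_split[OF X less.prems(1) v(1) False] by metis
      then have psub: "W1 \<subset> W" "W2 \<subset> W" by blast+
      then have "W1 \<subseteq> \<Union>X" "W2 \<subseteq> \<Union>X" "W1 \<noteq> {}" "W2 \<noteq> {}" using less.prems(2) S(2) by blast+
      then have "alternating_sum (induced_complex X W1) \<ge> 0" "alternating_sum (induced_complex X W2) \<ge> 0"
        using less.hyps[OF psubset_card_mono[OF fin psub(1)] S(5)]
          less.hyps[OF psubset_card_mono[OF fin psub(2)] S(6)] by blast+
      moreover have "v \<in> \<Union>X" using v(1) less.prems(2) by blast
      ultimately show ?thesis using induced_sum_wedge[OF S(7,2)] by linarith
    qed
  qed
qed

text \<open>
  The vertex \<open>u\<close> to be avoided is there for the induction: at a cut vertex \<open>w\<close>, the vertex is sought in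
  a part that contains \<open>u\<close> at most as \<open>w\<close>, and it must differ from \<open>w\<close>. If there is no cut vertex,
  then the deletion of any vertex leaves a connected complex, whose sum is nonnegative; this rules
  out that a forest that occurs as a link has several components.
\<close>

lemma exists_vertex_with_non_evasive_link:
  assumes "edge_connected_on X W" "W \<subseteq> \<Union>X" "card W \<ge> 2" "alternating_sum (induced_complex X W) = 0"
  shows "\<exists>v\<in>W. v \<noteq> u \<and> abstract_non_evasive (vertex_link v (induced_complex X W))"
  using assms
proof (induction "card W" arbitrary: W u rule: less_induct)
  case less
  have fin: "finite W" using finite_vertices less.prems(2) by blast
  show ?case
  proof (cases "\<exists>w\<in>W. \<not> edge_connected_on X (W - {w})")
    case True
    then obtain w where w: "w \<in> W" "\<not> edge_connected_on X (W - {w})" by blast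
    obtain W1 W2 where S: "W1 \<union> W2 = W" "W1 \<inter> W2 = {w}" "W1 \<noteq> {w}" "W2 \<noteq> {w}"
      "edge_connected_on X W1" "edge_connected_on X W2"
      "induced_complex X W = induced_complex X W1 \<union> induced_complex X W2"
      using edge_connected_split[OF X less.prems(1) w] by metis
    have "W1 \<subseteq> \<Union>X" "W2 \<subseteq> \<Union>X" "W1 \<noteq> {}" "W2 \<noteq> {}"
      using less.prems(2) S(1,2) by blast+
    note nonneg = connected_sum_nonneg[OF S(5) this(1,3)] connected_sum_nonneg[OF S(6) this(2,4)]
    have "w \<in> \<Union>X" using less.prems(2) w(1) by blast
    then have sums: "alternating_sum (induced_complex X W1) = 0" "alternating_sum (induced_complex X W2) = 0"
      using nonneg induced_sum_wedge[OF S(7,2)] less.prems(4) by linarith+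
    \<comment> \<open>A vertex of one of the two parts, other than \<open>w\<close>, has the same link in this part and in the whole.\<close>
    have part: ?thesis
      if P: "P \<union> Q = W" "P \<inter> Q = {w}" "P \<noteq> {w}" "Q \<noteq> {w}" "edge_connected_on X P"
        "induced_complex X W = induced_complex X P \<union> induced_complex X Q"
        "alternating_sum (induced_complex X P) = 0" "u \<notin> P - {w}" for P Q
    proof -
      have PW: "P \<subset> W" "finite P" using P fin by auto
      have "card P \<ge> 2"
      proof -
        obtain b where "b \<in> P" "b \<noteq> w" using P(2,3) by blast
        then have "{w, b} \<subseteq> P" "card {w, b} = 2" using P(2) by auto
        then show ?thesis using card_mono[OF PW(2), of "{w, b}"] by simp
      qed
      then obtain v where v: "v \<in> P" "v \<noteq> w" "abstract_non_evasive (vertex_link v (induced_complex X P))"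
        using less.hyps[OF psubset_card_mono[OF fin PW(1)] P(5) _ _ P(7), of w] PW less.prems(2) by blast
      have "v \<notin> Q" using v P(2) by blast
      then have "insert v s \<in> induced_complex X W \<longleftrightarrow> insert v s \<in> induced_complex X P" for s
        unfolding P(6) by (simp add: induced_complex_def)
      moreover have "s \<in> induced_complex X P" if "insert v s \<in> induced_complex X P" for s
        using abstract_complex_subset[OF abstract_complex_induced[OF X] that subset_insertI] .
      moreover have "induced_complex X P \<subseteq> induced_complex X W" unfolding P(6) by simp
      ultimately have "vertex_link v (induced_complex X W) = vertex_link v (induced_complex X P)"
        unfolding vertex_link_def by (intro Collect_cong) (metis subsetD)
      then show ?thesis using v P(1,8) by (metis DiffI UnI1 singletonD)
    qed
    show ?thesis
    proof (cases "u \<in> W1 - {w}")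
      case True
      then have "u \<notin> W2 - {w}" using S(2) by blast
      then show ?thesis using part[of W2 W1] S sums(2) by (simp add: Un_commute Int_commute)
    qed (use part[of W1 W2] S sums(1) in simp)
  next
    case False
    obtain v where v: "v \<in> W" "v \<noteq> u" "forest_like (vertex_link v (induced_complex X W))"
      using forest_links[OF less.prems(2,3)] by metis
    have "W \<noteq> {v}" using less.prems(3) by auto
    then have "W - {v} \<noteq> {}" using v(1) by blast
    moreover have "edge_connected_on X (W - {v})" "W - {v} \<subseteq> \<Union>X"
      using False v(1) less.prems(2) by blast+
    ultimately have "alternating_sum (induced_complex X (W - {v})) \<ge> 0"
      using connected_sum_nonneg by blast
    then have "\<not> alternating_sum (vertex_link v (induced_complex X W)) < 0"
      using induced_sum_split[of W v] less.prems(4) by simp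
    then show ?thesis
      using link_alternatives[OF less.prems(1-3) v(1,3)] v by blast
  qed
qed

lemma non_evasive_if_sum_0:
  assumes "edge_connected_on X W" "W \<subseteq> \<Union>X" "W \<noteq> {}" "alternating_sum (induced_complex X W) = 0"
  shows "abstract_non_evasive (induced_complex X W)"
  using assms
proof (induction "card W" arbitrary: W rule: less_induct)
  case less
  have fin: "finite W" using finite_vertices less.prems(2) by blast
  show ?case
  proof (cases "card W \<ge> 2")
    case False
    moreover have "card W > 0" using less.prems(3) fin by (simp add: card_gt_0_iff)
    ultimately have "card W = 1" by linarith
    then obtain w where "W = {w}" using card_1_singletonE by blast
    then show ?thesis
      using induced_complex_singleton[OF X] less.prems(2) abstract_non_evasive.point by auto
  next
    case True
    obtain v where v: "v \<in> W" and link: "abstract_non_evasive (vertex_link v (induced_complex X W))"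
      using exists_vertex_with_non_evasive_link[OF less.prems(1,2) True less.prems(4)] by blast
    have "W \<noteq> {v}" using True by auto
    then have "W - {v} \<noteq> {}" using v by blast
    moreover have "alternating_sum (induced_complex X (W - {v})) = 0"
      using induced_sum_split[of W v] less.prems(4) abstract_non_evasive_alternating_sum[OF link]
        abstract_complex_vertex_link[OF abstract_complex_induced[OF X]] by simp
    moreover have "edge_connected_on X (W - {v})"
      by (rule edge_connected_delete_vertex[OF X less.prems(1) v link])
    ultimately have "abstract_non_evasive (induced_complex X (W - {v}))"
      using less.hyps[of "W - {v}"] card_Diff1_less[OF fin v] less.prems(2) by blast
    moreover have "{v} \<in> induced_complex X W"
      using abstract_complex_vertex[OF X, of v] v less.prems(2) by (auto simp: induced_complex_def)
    ultimately show ?thesis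
      using link abstract_non_evasive.step by (metis vertex_deletion_induced)
  qed
qed

end

section \<open>Planar complexes\<close>

lemma finite_maximizer:
  fixes f :: "'b \<Rightarrow> real"
  assumes "finite S" "S \<noteq> {}"
  shows "\<exists>x\<in>S. \<forall>y\<in>S. f y \<le> f x"
proof -
  have "Max (f ` S) \<in> f ` S" using assms by simp
  then obtain x where "x \<in> S" "Max (f ` S) = f x" by blast
  moreover have "f y \<le> Max (f ` S)" if "y \<in> S" for y using assms(1) that by simp
  ultimately show ?thesis by auto
qed

text \<open>
  Among the functionals \<open>e1 + \<tau> e2\<close>, only finitely many fail to separate two given points of \<open>V\<close>.
\<close>

lemma exists_generic_functional:
  fixes V :: "'a::euclidean_space set"
  assumes "finite V" "DIM('a) = 2"
  obtains a b :: 'a where "\<And>z. a \<bullet> z = 0 \<Longrightarrow> b \<bullet> z = 0 \<Longrightarrow> z = 0" "inj_on (\<lambda>z. a \<bullet> z) V"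
proof -
  obtain e1 e2 :: 'a where B: "Basis = {e1, e2}" "e1 \<noteq> e2"
    using assms(2) by (metis card_2_iff)
  let ?bad = "\<lambda>d. {\<tau>::real. (e1 + \<tau> *\<^sub>R e2) \<bullet> d = 0}"
  have "finite (?bad d)" if "d \<noteq> 0" for d
  proof (cases "e2 \<bullet> d = 0")
    case True
    have "e1 \<bullet> d \<noteq> 0"
    proof
      assume "e1 \<bullet> d = 0"
      then have "\<forall>u\<in>Basis. d \<bullet> u = 0" using True unfolding B(1) by (simp add: inner_commute)
      then show False using that euclidean_all_zero_iff by blast
    qed
    then show ?thesis using True by (simp add: inner_add_left)
  next
    case False
    then have "?bad d \<subseteq> {- (e1 \<bullet> d) / (e2 \<bullet> d)}" by (auto simp: inner_add_left field_simps)
    then show ?thesis by (rule finite_subset) simp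
  qed
  moreover define \<D> where "\<D> = (\<lambda>(v, w). v - w) ` (V \<times> V) - {0}"
  moreover have "finite \<D>" using assms(1) by (simp add: \<D>_def)
  ultimately have "finite (\<Union>(?bad ` \<D>))" by (intro finite_UN_I) auto
  then obtain \<tau> where \<tau>: "\<tau> \<notin> \<Union>(?bad ` \<D>)"
    using ex_new_if_finite[OF infinite_UNIV_char_0] by blast
  show thesis
  proof
    show "z = 0" if "(e1 + \<tau> *\<^sub>R e2) \<bullet> z = 0" "e2 \<bullet> z = 0" for z
    proof -
      have "e1 \<bullet> z = 0" using that by (simp add: inner_add_left)
      then have "\<forall>u\<in>Basis. z \<bullet> u = 0" using that(2) unfolding B(1) by (simp add: inner_commute)
      then show ?thesis using euclidean_all_zero_iff by blast
    qed
    show "inj_on (\<lambda>z. (e1 + \<tau> *\<^sub>R e2) \<bullet> z) V"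
    proof (rule inj_onI, rule ccontr)
      fix v w assume "v \<in> V" "w \<in> V" "(e1 + \<tau> *\<^sub>R e2) \<bullet> v = (e1 + \<tau> *\<^sub>R e2) \<bullet> w" "v \<noteq> w"
      moreover from this have "v - w \<in> \<D>" by (auto simp: \<D>_def)
      ultimately show False using \<tau> by (auto simp: inner_diff_right)
    qed
  qed
qed

text \<open>
  Two triangles on the same side of a common edge overlap: the midpoint of the edge, pushed a
  little towards the third vertex of one triangle, lies in both.
\<close>

lemma triangles_same_side_overlap:
  fixes v w p q a b :: "'a::euclidean_space"
  defines "cr \<equiv> \<lambda>x y. (a \<bullet> (x - v)) * (b \<bullet> (y - v)) - (b \<bullet> (x - v)) * (a \<bullet> (y - v))"
  assumes coord: "\<And>z. a \<bullet> z = 0 \<Longrightarrow> b \<bullet> z = 0 \<Longrightarrow> z = 0"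
    and side: "cr w p < 0" "cr w q < 0"
  shows "\<not> convex hull {v, w, p} \<inter> convex hull {v, w, q} \<subseteq> convex hull {v, w}"
proof
  assume sub: "convex hull {v, w, p} \<inter> convex hull {v, w, q} \<subseteq> convex hull {v, w}"
  define \<mu> \<kappa> where "\<mu> = cr w q / cr w p" and "\<kappa> = cr q p / cr w p"
  have \<mu>: "\<mu> > 0" using side by (simp add: \<mu>_def zero_less_divide_iff)
  have q: "q - v = \<kappa> *\<^sub>R (w - v) + \<mu> *\<^sub>R (p - v)"
  proof -
    have eq: "\<kappa> * cr w p = cr q p" "\<mu> * cr w p = cr w q" using side by (simp_all add: \<kappa>_def \<mu>_def)
    have "cr w p * (a \<bullet> (q - v) - (\<kappa> * (a \<bullet> (w - v)) + \<mu> * (a \<bullet> (p - v)))) =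
        cr w p * (a \<bullet> (q - v)) - (cr q p * (a \<bullet> (w - v)) + cr w q * (a \<bullet> (p - v)))"
      unfolding eq[symmetric] by (simp add: algebra_simps)
    also have "\<dots> = 0" by (simp add: cr_def algebra_simps)
    finally have A: "a \<bullet> (q - v) = \<kappa> * (a \<bullet> (w - v)) + \<mu> * (a \<bullet> (p - v))" using side by simp
    have "cr w p * (b \<bullet> (q - v) - (\<kappa> * (b \<bullet> (w - v)) + \<mu> * (b \<bullet> (p - v)))) =
        cr w p * (b \<bullet> (q - v)) - (cr q p * (b \<bullet> (w - v)) + cr w q * (b \<bullet> (p - v)))"
      unfolding eq[symmetric] by (simp add: algebra_simps)
    also have "\<dots> = 0" by (simp add: cr_def algebra_simps)
    finally have B: "b \<bullet> (q - v) = \<kappa> * (b \<bullet> (w - v)) + \<mu> * (b \<bullet> (p - v))" using side by simp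
    have "(q - v) - (\<kappa> *\<^sub>R (w - v) + \<mu> *\<^sub>R (p - v)) = 0"
    proof (rule coord)
      show "a \<bullet> (q - v - (\<kappa> *\<^sub>R (w - v) + \<mu> *\<^sub>R (p - v))) = 0"
        using A by (simp only: inner_diff_right[of _ "q - v"] inner_add_right inner_scaleR_right)
      show "b \<bullet> (q - v - (\<kappa> *\<^sub>R (w - v) + \<mu> *\<^sub>R (p - v))) = 0"
        using B by (simp only: inner_diff_right[of _ "q - v"] inner_add_right inner_scaleR_right)
    qed
    then show ?thesis by simp
  qed
  define t where "t = 1 / (4 * (1 + \<bar>\<kappa>\<bar> + \<mu>))"
  have t: "0 < t" "t \<le> 1/4" "t * \<bar>\<kappa>\<bar> \<le> 1/4" "t * \<mu> \<le> 1/4"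
    using \<mu> by (auto simp: t_def field_simps)
  have "\<bar>t * \<kappa>\<bar> \<le> 1/4" using t(1,3) by (simp add: abs_mult)
  then have t\<kappa>: "t * \<kappa> \<le> 1/4" "- 1/4 \<le> t * \<kappa>" by linarith+
  define z where "z = v + (1/2) *\<^sub>R (w - v) + t *\<^sub>R (q - v)"
  have "z = (1 - 1/2 - t) *\<^sub>R v + (1/2) *\<^sub>R w + t *\<^sub>R q"
    by (simp add: z_def algebra_simps) (simp flip: scaleR_add_left)
  moreover have "0 \<le> 1 - 1/2 - t" using t by simp
  ultimately have zq: "z \<in> convex hull {v, w, q}"
    using t(1) unfolding convex_hull_3 by (intro CollectI exI[of _ "1 - 1/2 - t"] exI[of _ "1/2"] exI[of _ t]) simp
  let ?s = "1/2 + t * \<kappa>"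
  have "z = (1 - ?s - t * \<mu>) *\<^sub>R v + ?s *\<^sub>R w + (t * \<mu>) *\<^sub>R p"
    unfolding z_def q by (simp add: algebra_simps) (simp flip: scaleR_add_left)
  moreover have "0 \<le> 1 - ?s - t * \<mu>" "0 \<le> ?s" "0 \<le> t * \<mu>" using t t\<kappa> \<mu> by auto
  ultimately have "z \<in> convex hull {v, w, p}"
    unfolding convex_hull_3 by (intro CollectI exI[of _ "1 - ?s - t * \<mu>"] exI[of _ ?s] exI[of _ "t * \<mu>"]) simp
  then have "z \<in> convex hull {v, w}" using zq sub by blast
  then obtain x y where xy: "x + y = 1" "z = x *\<^sub>R v + y *\<^sub>R w" unfolding convex_hull_2 by blast
  have "x = 1 - y" using xy(1) by simp
  then have "z = v + y *\<^sub>R (w - v)"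
    unfolding xy(2) by (simp add: scaleR_diff_left scaleR_diff_right)
  then have "t *\<^sub>R (q - v) = (y - 1/2) *\<^sub>R (w - v)"
    unfolding z_def by (simp add: scaleR_left_diff_distrib eq_diff_eq add.commute)
  then have "a \<bullet> (t *\<^sub>R (q - v)) = a \<bullet> ((y - 1/2) *\<^sub>R (w - v))" "b \<bullet> (t *\<^sub>R (q - v)) = b \<bullet> ((y - 1/2) *\<^sub>R (w - v))"
    by simp_all
  then have ab: "t * (a \<bullet> (q - v)) = (y - 1/2) * (a \<bullet> (w - v))" "t * (b \<bullet> (q - v)) = (y - 1/2) * (b \<bullet> (w - v))"
    by (simp_all only: inner_scaleR_right)
  have "t * cr w q = (a \<bullet> (w - v)) * (t * (b \<bullet> (q - v))) - (b \<bullet> (w - v)) * (t * (a \<bullet> (q - v)))"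
    by (simp add: cr_def algebra_simps)
  also have "\<dots> = 0" unfolding ab by simp
  finally show False using t(1) side(2) by simp
qed

text \<open>
  At a vertex \<open>v\<close> that is extreme for the functional \<open>a\<close>, the edges are ordered by slope. All
  triangles over the steepest of any set of edges at \<open>v\<close> lie on the same side of it, so there is
  at most one.
\<close>

lemma forest_like_link_of_extreme_vertex:
  fixes X :: "'a::euclidean_space set set"
  assumes X: "geometric_scheme X"
    and coord: "\<And>z. a \<bullet> z = 0 \<Longrightarrow> b \<bullet> z = 0 \<Longrightarrow> z = 0"
    and v: "{v} \<in> X" "v \<in> W" and pos: "\<And>w. w \<in> W \<Longrightarrow> w \<noteq> v \<Longrightarrow> a \<bullet> (w - v) > 0"
  shows "forest_like (vertex_link v (induced_complex X W))"
proof -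
  let ?L = "vertex_link v (induced_complex X W)"
  have ac: "abstract_complex X" using X by (simp add: geometric_scheme_def)
  then have L: "abstract_complex ?L"
    by (intro abstract_complex_vertex_link abstract_complex_induced)
  have "{} \<in> ?L"
    using v abstract_complex_subset[OF ac v(1)] by (simp add: vertex_link_def induced_complex_def)
  have fin: "finite (\<Union>?L)" using L by (simp add: abstract_complex_def)
  have LW: "\<And>w. w \<in> \<Union>?L \<Longrightarrow> w \<in> W \<and> w \<noteq> v" by (auto simp: vertex_link_def induced_complex_def)
  define slope where "slope = (\<lambda>w. (b \<bullet> (w - v)) / (a \<bullet> (w - v)))"
  let ?cr = "\<lambda>x y. (a \<bullet> (x - v)) * (b \<bullet> (y - v)) - (b \<bullet> (x - v)) * (a \<bullet> (y - v))"
  have cr: "?cr w p < 0" if w: "w \<in> W" "w \<noteq> v" "p \<in> W" "p \<noteq> v" "w \<noteq> p" "slope p \<le> slope w" "{v, w, p} \<in> X" for w p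
  proof -
    have A: "a \<bullet> (w - v) > 0" "a \<bullet> (p - v) > 0" using pos w by blast+
    then have "?cr w p \<le> 0" using w(6) by (simp add: slope_def divide_le_eq pos_le_divide_eq frac_le_eq field_simps)
    moreover have "?cr w p \<noteq> 0"
    proof
      assume 0: "?cr w p = 0"
      define k where "k = (a \<bullet> (p - v)) / (a \<bullet> (w - v))"
      have "p - v - k *\<^sub>R (w - v) = 0"
      proof (rule coord)
        show "a \<bullet> (p - v - k *\<^sub>R (w - v)) = 0"
          using A by (simp only: inner_diff_right[of _ "p - v"] inner_scaleR_right k_def) simp
        show "b \<bullet> (p - v - k *\<^sub>R (w - v)) = 0"
          using A 0 by (simp only: inner_diff_right[of _ "p - v"] inner_scaleR_right k_def) (simp add: field_simps)
      qed
      then have "p = (1 - k) *\<^sub>R v + k *\<^sub>R w" by (simp add: algebra_simps)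
      then have "p \<in> affine hull {v, w}" unfolding affine_hull_2 by (intro CollectI exI[of _ "1 - k"] exI[of _ k]) simp
      moreover have "{v, w, p} - {p} = {v, w}" using w by auto
      ultimately have "affine_dependent {v, w, p}" unfolding affine_dependent_def by (metis insertCI)
      then show False using X w(7) unfolding geometric_scheme_def by blast
    qed
    ultimately show ?thesis by simp
  qed
  show ?thesis
  proof (rule forest_like_from_leaves[OF L \<open>{} \<in> ?L\<close>])
    fix U assume U: "U \<subseteq> \<Union>?L" "U \<noteq> {}"
    have "finite U" using U(1) fin finite_subset by blast
    then obtain w where w: "w \<in> U" "\<And>u. u \<in> U \<Longrightarrow> slope u \<le> slope w"
      using U(2) finite_maximizer[of U slope] by blast
    let ?M = "vertex_link w (induced_complex ?L U)"
    have M: "abstract_complex ?M"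
      by (intro abstract_complex_vertex_link abstract_complex_induced L)
    have "{w} \<in> ?L" using abstract_complex_vertex[OF L] w(1) U(1) by blast
    then have "{} \<in> ?M"
      using \<open>{} \<in> ?L\<close> w(1) by (simp add: vertex_link_def[of w] induced_complex_def[of ?L])
    have wW: "w \<in> W" "w \<noteq> v" using LW w(1) U(1) by blast+
    have third: "u \<in> U \<and> u \<in> W \<and> u \<noteq> v \<and> u \<noteq> w \<and> {v, w, u} \<in> X" if "u \<in> \<Union>?M" for u
    proof -
      have "{u} \<in> ?M" using abstract_complex_vertex[OF M that] .
      then have "u \<noteq> w" "u \<in> U" "{w, u} \<in> ?L" by (auto simp: vertex_link_def[of w] induced_complex_def[of ?L])
      moreover from this have "{v, w, u} \<in> X" by (simp add: vertex_link_def induced_complex_def)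
      ultimately show ?thesis using LW U(1) by blast
    qed
    have unique: "p = q" if "p \<in> \<Union>?M" "q \<in> \<Union>?M" for p q
    proof (rule ccontr)
      assume "p \<noteq> q"
      then have "{v, w, p} \<inter> {v, w, q} = {v, w}" using third that by auto
      moreover have "{v, w, p} \<in> X" "{v, w, q} \<in> X" using third that by blast+
      ultimately have "convex hull {v, w, p} \<inter> convex hull {v, w, q} \<subseteq> convex hull {v, w}"
        using X unfolding geometric_scheme_def by metis
      moreover have "?cr w p < 0" "?cr w q < 0"
        using cr[OF wW] third that w(2) by metis+
      ultimately show False using triangles_same_side_overlap[OF coord] by blast
    qed
    have "?M = {{}} \<or> (\<exists>p. ?M = {{}, {p}})"
    proof (cases "\<Union>?M = {}")
      case True
      then have "?M = {{}}" using \<open>{} \<in> ?M\<close> by blast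
      then show ?thesis by blast
    next
      case False
      then obtain p where p: "p \<in> \<Union>?M" by blast
      then have "\<Union>?M = {p}" using unique by blast
      then have "?M \<subseteq> {{}, {p}}" by (auto simp: subset_singleton_iff)
      moreover have "{p} \<in> ?M" using abstract_complex_vertex[OF M p] .
      ultimately show ?thesis using \<open>{} \<in> ?M\<close> by blast
    qed
    then show "\<exists>w\<in>U. vertex_link w (induced_complex ?L U) = {{}} \<or> (\<exists>p. vertex_link w (induced_complex ?L U) = {{}, {p}})"
      using w(1) by blast
  qed
qed

text \<open>
  The two vertices are those where a generic functional attains its minimum and its maximum.
\<close>

lemma planar_geometric_scheme:
  fixes X :: "'a::euclidean_space set set"
  assumes X: "geometric_scheme X" and dim: "DIM('a) = 2"
  shows "planar_like_complex X"
proof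
  show ac: "abstract_complex X" using X by (simp add: geometric_scheme_def)
  fix W assume W: "W \<subseteq> \<Union>X" "card W \<ge> 2"
  have finX: "finite (\<Union>X)" using ac by (simp add: abstract_complex_def)
  obtain a b :: 'a where ab: "\<And>z. a \<bullet> z = 0 \<Longrightarrow> b \<bullet> z = 0 \<Longrightarrow> z = 0" "inj_on (\<lambda>z. a \<bullet> z) (\<Union>X)"
    using exists_generic_functional[OF finX dim] by blast
  have fin: "finite W" "W \<noteq> {}" using W finX finite_subset by auto
  have inj: "inj_on (\<lambda>z. a \<bullet> z) W" using ab(2) W(1) inj_on_subset by blast
  obtain v where v: "v \<in> W" "\<And>w. w \<in> W \<Longrightarrow> a \<bullet> v \<le> a \<bullet> w"
    using finite_maximizer[OF fin, of "\<lambda>w. - (a \<bullet> w)"] by auto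
  obtain v' where v': "v' \<in> W" "\<And>w. w \<in> W \<Longrightarrow> a \<bullet> w \<le> a \<bullet> v'"
    using finite_maximizer[OF fin, of "\<lambda>w. a \<bullet> w"] by auto
  have "v \<in> \<Union>X" "v' \<in> \<Union>X" using v(1) v'(1) W(1) by blast+
  then have vX: "{v} \<in> X" "{v'} \<in> X" by (simp_all only: abstract_complex_vertex[OF ac])
  have "v \<noteq> v'"
  proof
    assume "v = v'"
    then have "a \<bullet> w = a \<bullet> v" if "w \<in> W" for w using v(2) v'(2) that by (metis order_antisym)
    then have "W \<subseteq> {v}" using inj v(1) by (auto dest: inj_onD)
    then show False using W(2) card_mono[of "{v}" W] by simp
  qed
  moreover have "forest_like (vertex_link v (induced_complex X W))"
  proof (rule forest_like_link_of_extreme_vertex[OF X ab(1) vX(1) v(1)])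
    show "a \<bullet> (w - v) > 0" if "w \<in> W" "w \<noteq> v" for w
      using v that inj by (simp add: inner_diff_right order_less_le inj_on_eq_iff)
  qed
  moreover have "forest_like (vertex_link v' (induced_complex X W))"
  proof (rule forest_like_link_of_extreme_vertex[OF X _ vX(2) v'(1), of "- a" b])
    show "z = 0" if "- a \<bullet> z = 0" "b \<bullet> z = 0" for z using ab(1)[of z] that by simp
    show "- a \<bullet> (w - v') > 0" if "w \<in> W" "w \<noteq> v'" for w
      using v' that inj by (simp add: inner_diff_right order_less_le inj_on_eq_iff)
  qed
  ultimately show "\<exists>v\<in>W. \<exists>v'\<in>W. v \<noteq> v' \<and> forest_like (vertex_link v (induced_complex X W)) \<and>
      forest_like (vertex_link v' (induced_complex X W))"
    by (intro bexI[OF _ v(1)] bexI[OF _ v'(1)] conjI)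
qed

text \<open>
  Connectivity and Euler characteristic pass from the subdivision to the complex itself, and in the
  plane they determine non-evasiveness.
\<close>

lemma planar_complex_non_evasive_if_subdivision:
  fixes C :: "'a::euclidean_space set set"
  assumes dim: "DIM('a) = 2" and C: "simplicial_complex C"
    and sub: "abstract_non_evasive (order_complex (C - {{}}))"
  shows "non_evasive C \<and> collapsible C"
proof -
  obtain X where X: "geometric_scheme X" "C = (hull) convex ` X"
    by (rule simplicial_complex_geometric_scheme[OF C])
  interpret planar: planar_like_complex X by (rule planar_geometric_scheme[OF X(1) dim])
  have ac: "abstract_complex X" using X(1) by (simp add: geometric_scheme_def)
  let ?S = "X - {{}}"
  have "C - {{}} = (hull) convex ` ?S" unfolding X(2) by auto
  then have ne: "abstract_non_evasive (order_complex ?S)"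
    using sub geometric_scheme_hull_mono_iff(1)[OF X(1)]
    by (intro abstract_non_evasive_order_complex_iso[of "(hull) convex" ?S]) auto
  have fin: "finite ?S" using ac by (simp add: abstract_complex_def)
  have acS: "abstract_complex (order_complex ?S)" by (rule abstract_complex_order_complex[OF fin])
  obtain F where "F \<in> ?S"
    using abstract_non_evasive_has_vertex[OF ne] by (auto simp: order_complex_def subset_chain_def)
  then have X_ne: "{} \<in> X" "\<Union>X \<noteq> {}" using abstract_complex_subset[OF ac, of F "{}"] by auto
  have "edge_connected_on (order_complex ?S) ?S"
    using abstract_non_evasive_edge_connected[OF ne acS] by (simp only: Union_order_complex)
  then have conn: "edge_connected_on X (\<Union>X)" by (rule edge_connected_subdivision[OF ac])
  have "induced_complex X (\<Union>X) = X" by (auto simp: induced_complex_def)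
  moreover have "alternating_sum X = 0"
    using alternating_sum_subdivision[OF ac X_ne(1)] abstract_non_evasive_alternating_sum[OF ne acS] by simp
  ultimately have "abstract_non_evasive X"
    using planar.non_evasive_if_sum_0[OF conn order_refl X_ne(2)] by simp
  then show ?thesis using geometric_scheme_non_evasive[OF X(1)] X(2) by simp
qed

theorem theorem3p0p6:
  fixes C D :: "'a::euclidean_space set set"
  assumes "(DIM('a) \<ge> 3 \<and> polytopal_complex C) \<or> (DIM('a) = 2 \<and> simplicial_complex C)"
    and "starlike (\<Union>C)"
    and "(derived_subdivision ^^ (DIM('a) - 2)) C D"
  shows "non_evasive D \<and> collapsible D"
proof -
  have star: "abstract_non_evasive (order_complex (B - {{}}))"
    if B: "polytopal_complex B" "\<Union>B = \<Union>C" for B :: "'a set set"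
  proof -
    obtain x where "x \<in> \<Union>B" "\<And>w. w \<in> \<Union>B \<Longrightarrow> closed_segment x w \<subseteq> \<Union>B"
      using assms(2) B(2) unfolding starlike_def by metis
    then show ?thesis
      using star_shaped_order_complex_non_evasive[OF polytopal_imp_polyhedral_complex[OF B(1)]] by blast
  qed
  from assms(1) show ?thesis
  proof
    assume d: "DIM('a) \<ge> 3 \<and> polytopal_complex C"
    then have "DIM('a) - 2 = Suc (DIM('a) - 3)" by arith
    then obtain B where B: "(derived_subdivision ^^ (DIM('a) - 3)) C B" "derived_subdivision B D"
      using assms(3) by auto
    then have "polytopal_complex B" "\<Union>B = \<Union>C"
      using derived_subdivisions_polytopal_complex d by blast+
    then show ?thesis using derived_subdivision_non_evasive[OF _ B(2)] star by blast
  next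
    assume d: "DIM('a) = 2 \<and> simplicial_complex C"
    then have "D = C" using assms(3) by simp
    then show ?thesis
      using planar_complex_non_evasive_if_subdivision d star simplicial_imp_polytopal_complex by blast
  qed
qed

end
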